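(* Let $A = \sigma(R)\langle x_1, \dots, x_n\rangle$ be a skew PBW extension over a $(\Sigma,\Delta)$-compatible and NI ring $R$. If for each $p\in R$ with $p\notin N(R)$, $N_R(p)$ is generated as an ideal by a nilpotent element, then for each $f\in A$ with $f\notin N(A)$, $N_A(f)$ is generated as an ideal by a nilpotent element.
   Context: All rings are associative with identity, not necessarily commutative. $\mathbb{N}$ includes $0$. For a ring $R$, $N(R)$ is the set of nilpotent elements of $R$ and $N^*(R)$ is the sum of all nil ideals of $R$; $R$ is NI if $N^*(R)=N(R)$. Skew PBW extension: $A=\sigma(R)\langle x_1,\dots,x_n\rangle$ is a skew PBW extension over $R$ if (i) $R$ is a subring of $A$ with the same identity; (ii) there are $x_1,\dots,x_n\in A$ such that $A$ is a free left $R$-module with basis $\mathrm{Mon}(A)=\{x^\alpha = x_1^{\alpha_1}\cdots x_n^{\alpha_n} \mid \alpha\in\mathbb{N}^n\}$; (iii) for each $1\le i\le n$ and $r\in R\setminus\{0\}$ there is $c_{i,r}\in R\setminus\{0\}$ with $x_i r - c_{i,r}x_i\in R$; (iv) for all $1\le i,j\le n$ there is $d_{i,j}\in R\setminus\{0\}$ with $x_jx_i - d_{i,j}x_ix_j\in R+Rx_1+\cdots+Rx_n$. For such $A$ there exist, for each $i$, an injective endomorphism $\sigma_i$ of $R$ and a $\sigma_i$-derivation $\delta_i$ of $R$ (additive, $\delta_i(rs)=\sigma_i(r)\delta_i(s)+\delta_i(r)s$) with $x_ir=\sigma_i(r)x_i+\delta_i(r)$ for all $r\in R$. Put $\Sigma=\{\sigma_1,\dots,\sigma_n\}$,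 $\Delta=\{\delta_1,\dots,\delta_n\}$, and for $\alpha\in\mathbb{N}^n$, $\sigma^\alpha=\sigma_1^{\alpha_1}\circ\cdots\circ\sigma_n^{\alpha_n}$, $\delta^\alpha=\delta_1^{\alpha_1}\circ\cdots\circ\delta_n^{\alpha_n}$. $R$ is $\Sigma$-compatible if for all $a,b\in R$ and $\alpha\in\mathbb{N}^n$: $a\sigma^\alpha(b)=0$ if and only if $ab=0$. $R$ is $\Delta$-compatible if for all $a,b\in R$ and $\beta\in\mathbb{N}^n$: $ab=0$ implies $a\delta^\beta(b)=0$. $R$ is $(\Sigma,\Delta)$-compatible if it is both. Weak annihilator: for a ring $S$ and $X\subseteq S$, $N_S(X)=\{a\in S\mid xa\in N(S)\text{ for all }x\in X\}$, and $N_S(r)$ means $N_S(\{r\})$; it is an ideal of $S$ whenever $N(S)$ is. "$N_S(X)$ is generated as an ideal by a nilpotent element" is used in the form: there is $c\in N(S)$ with $N_S(X)=cS$. *)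

theory Defs
  imports "HOL-Algebra.Subrings"
begin

text \<open>
  Rings are those of \<open>HOL-Algebra\<close>: associative with identity, not necessarily commutative,
  the zero ring included. A subring \<open>R\<close> of \<open>A\<close> is regarded as a ring of its own through
  \<open>A\<lparr>carrier := R\<rparr>\<close>. The indices \<open>1, \<dots>, n\<close> are shifted to \<open>0, \<dots>, n - 1\<close>.
\<close>

section \<open>Nilpotent elements, NI rings, weak annihilators\<close>

definition nilpotents :: "('a, 'b) ring_scheme \<Rightarrow> 'a set" where
  "nilpotents S = {a \<in> carrier S. \<exists>k::nat. a [^]\<^bsub>S\<^esub> k = \<zero>\<^bsub>S\<^esub>}"

definition nil_ideal :: "'a set \<Rightarrow> ('a, 'b) ring_scheme \<Rightarrow> bool" where
  "nil_ideal I S \<longleftrightarrow> ideal I S \<and> I \<subseteq> nilpotents S"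

definition upper_nilradical :: "('a, 'b) ring_scheme \<Rightarrow> 'a set" where
  "upper_nilradical S =
     {\<Oplus>\<^bsub>S\<^esub>I\<in>F. a I | F a. finite F \<and> (\<forall>I\<in>F. nil_ideal I S \<and> a I \<in> I)}"

definition NI_ring :: "('a, 'b) ring_scheme \<Rightarrow> bool" where
  "NI_ring S \<longleftrightarrow> ring S \<and> upper_nilradical S = nilpotents S"

definition weak_annihilator :: "('a, 'b) ring_scheme \<Rightarrow> 'a set \<Rightarrow> 'a set" where
  "weak_annihilator S Y = {a \<in> carrier S. \<forall>y\<in>Y. y \<otimes>\<^bsub>S\<^esub> a \<in> nilpotents S}"

text \<open>
  ``\<open>J\<close> is generated as an ideal by a nilpotent element'' means \<open>J = cS\<close> with \<open>c\<close> nilpotent; the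
  one-sided set \<open>cS\<close> is intended, not the two-sided ideal \<open>ScS\<close>.
\<close>

definition nilpotently_generated :: "('a, 'b) ring_scheme \<Rightarrow> 'a set \<Rightarrow> bool" where
  "nilpotently_generated S J \<longleftrightarrow>
     (\<exists>c\<in>nilpotents S. J = {c \<otimes>\<^bsub>S\<^esub> s | s. s \<in> carrier S})"

section \<open>Skew PBW extensions\<close>

text \<open>Elements of \<open>\<nat>\<^sup>n\<close> are represented by functions vanishing from \<open>n\<close> on.\<close>

definition multi_exps :: "nat \<Rightarrow> (nat \<Rightarrow> nat) set" where
  "multi_exps n = {\<alpha>. \<forall>i\<ge>n. \<alpha> i = 0}"

text \<open>\<open>pbw_mon A x n \<alpha>\<close> is the ordered product of the \<open>x i [^] \<alpha> i\<close> for \<open>i < n\<close>.\<close>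

primrec pbw_mon ::
    "('a, 'b) ring_scheme \<Rightarrow> (nat \<Rightarrow> 'a) \<Rightarrow> nat \<Rightarrow> (nat \<Rightarrow> nat) \<Rightarrow> 'a" where
  "pbw_mon A x 0 \<alpha> = \<one>\<^bsub>A\<^esub>"
| "pbw_mon A x (Suc n) \<alpha> = pbw_mon A x n \<alpha> \<otimes>\<^bsub>A\<^esub> (x n [^]\<^bsub>A\<^esub> \<alpha> n)"

text \<open>
  The family \<open>(b i)\<^sub>i\<^sub>\<in>\<^sub>I\<close> is a basis of \<open>A\<close> as a left \<open>R\<close>-module. (The library's \<open>module\<close>
  requires commutative scalars.)
\<close>

definition free_left_basis ::
    "('a, 'b) ring_scheme \<Rightarrow> 'a set \<Rightarrow> 'i set \<Rightarrow> ('i \<Rightarrow> 'a) \<Rightarrow> bool" where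
  "free_left_basis A R I b \<longleftrightarrow>
     b ` I \<subseteq> carrier A \<and>
     (\<forall>a\<in>carrier A. \<exists>F c. finite F \<and> F \<subseteq> I \<and> c ` F \<subseteq> R \<and>
        a = (\<Oplus>\<^bsub>A\<^esub>i\<in>F. c i \<otimes>\<^bsub>A\<^esub> b i)) \<and>
     (\<forall>F c. finite F \<and> F \<subseteq> I \<and> c ` F \<subseteq> R \<and>
        (\<Oplus>\<^bsub>A\<^esub>i\<in>F. c i \<otimes>\<^bsub>A\<^esub> b i) = \<zero>\<^bsub>A\<^esub> \<longrightarrow> (\<forall>i\<in>F. c i = \<zero>\<^bsub>A\<^esub>))"

locale skew_PBW_extension = ring A
  for A :: "('a, 'b) ring_scheme" (structure) +
  fixes R :: "'a set" and n :: nat and x :: "nat \<Rightarrow> 'a"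
  assumes subring_R: "subring R A"
    and x_closed: "\<And>i. i < n \<Longrightarrow> x i \<in> carrier A"
    and basis: "free_left_basis A R (multi_exps n) (pbw_mon A x n)"
    and x_scalar: "\<And>i r. i < n \<Longrightarrow> r \<in> R - {\<zero>} \<Longrightarrow>
           \<exists>c\<in>R - {\<zero>}. x i \<otimes> r \<ominus> c \<otimes> x i \<in> R"
    and x_x: "\<And>i j. i < n \<Longrightarrow> j < n \<Longrightarrow>
           \<exists>d\<in>R - {\<zero>}. x j \<otimes> x i \<ominus> d \<otimes> (x i \<otimes> x j)
              \<in> {r \<oplus> (\<Oplus>k\<in>{..<n}. s k \<otimes> x k) | r s. r \<in> R \<and> s ` {..<n} \<subseteq> R}"

text \<open>
  The maps \<open>\<sigma>\<^sub>i\<close> and \<open>\<delta>\<^sub>i\<close> attached to a skew PBW extension; they exist and are determined on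
  \<open>R\<close> by the extension, see \<open>skew_PBW_maps_exist\<close> and \<open>skew_PBW_maps_unique\<close> below.
\<close>

definition skew_derivation ::
    "('a, 'b) ring_scheme \<Rightarrow> ('a \<Rightarrow> 'a) \<Rightarrow> ('a \<Rightarrow> 'a) \<Rightarrow> bool" where
  "skew_derivation S s d \<longleftrightarrow>
     d \<in> carrier S \<rightarrow> carrier S \<and>
     (\<forall>a\<in>carrier S. \<forall>b\<in>carrier S.
        d (a \<oplus>\<^bsub>S\<^esub> b) = d a \<oplus>\<^bsub>S\<^esub> d b \<and>
        d (a \<otimes>\<^bsub>S\<^esub> b) = s a \<otimes>\<^bsub>S\<^esub> d b \<oplus>\<^bsub>S\<^esub> d a \<otimes>\<^bsub>S\<^esub> b)"

definition skew_PBW_maps ::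
    "('a, 'b) ring_scheme \<Rightarrow> 'a set \<Rightarrow> nat \<Rightarrow> (nat \<Rightarrow> 'a) \<Rightarrow>
     (nat \<Rightarrow> 'a \<Rightarrow> 'a) \<Rightarrow> (nat \<Rightarrow> 'a \<Rightarrow> 'a) \<Rightarrow> bool" where
  "skew_PBW_maps A R n x \<sigma> \<delta> \<longleftrightarrow>
     (\<forall>i<n. \<sigma> i \<in> ring_hom (A\<lparr>carrier := R\<rparr>) (A\<lparr>carrier := R\<rparr>) \<and> inj_on (\<sigma> i) R \<and>
        skew_derivation (A\<lparr>carrier := R\<rparr>) (\<sigma> i) (\<delta> i) \<and>
        (\<forall>r\<in>R. x i \<otimes>\<^bsub>A\<^esub> r = \<sigma> i r \<otimes>\<^bsub>A\<^esub> x i \<oplus>\<^bsub>A\<^esub> \<delta> i r))"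

section \<open>Compatibility\<close>

text \<open>\<open>multi_comp f n \<alpha>\<close> is \<open>f\<^sub>0\<^bsup>\<alpha> 0\<^esup> \<circ> \<dots> \<circ> f\<^sub>n\<^sub>-\<^sub>1\<^bsup>\<alpha> (n-1)\<^esup>\<close>.\<close>

primrec multi_comp :: "(nat \<Rightarrow> 'a \<Rightarrow> 'a) \<Rightarrow> nat \<Rightarrow> (nat \<Rightarrow> nat) \<Rightarrow> 'a \<Rightarrow> 'a" where
  "multi_comp f 0 \<alpha> = id"
| "multi_comp f (Suc n) \<alpha> = multi_comp f n \<alpha> \<circ> (f n ^^ \<alpha> n)"

definition Sigma_compatible ::
    "('a, 'b) ring_scheme \<Rightarrow> nat \<Rightarrow> (nat \<Rightarrow> 'a \<Rightarrow> 'a) \<Rightarrow> bool" where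
  "Sigma_compatible S n \<sigma> \<longleftrightarrow>
     (\<forall>a\<in>carrier S. \<forall>b\<in>carrier S. \<forall>\<alpha>\<in>multi_exps n.
        a \<otimes>\<^bsub>S\<^esub> multi_comp \<sigma> n \<alpha> b = \<zero>\<^bsub>S\<^esub> \<longleftrightarrow> a \<otimes>\<^bsub>S\<^esub> b = \<zero>\<^bsub>S\<^esub>)"

definition Delta_compatible ::
    "('a, 'b) ring_scheme \<Rightarrow> nat \<Rightarrow> (nat \<Rightarrow> 'a \<Rightarrow> 'a) \<Rightarrow> bool" where
  "Delta_compatible S n \<delta> \<longleftrightarrow>
     (\<forall>a\<in>carrier S. \<forall>b\<in>carrier S. \<forall>\<beta>\<in>multi_exps n.
        a \<otimes>\<^bsub>S\<^esub> b = \<zero>\<^bsub>S\<^esub> \<longrightarrow> a \<otimes>\<^bsub>S\<^esub> multi_comp \<delta> n \<beta> b = \<zero>\<^bsub>S\<^esub>)"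

definition Sigma_Delta_compatible ::
    "('a, 'b) ring_scheme \<Rightarrow> nat \<Rightarrow> (nat \<Rightarrow> 'a \<Rightarrow> 'a) \<Rightarrow> (nat \<Rightarrow> 'a \<Rightarrow> 'a) \<Rightarrow> bool" where
  "Sigma_Delta_compatible S n \<sigma> \<delta> \<longleftrightarrow> Sigma_compatible S n \<sigma> \<and> Delta_compatible S n \<delta>"

section \<open>Existence and uniqueness of the attached maps\<close>

lemma pbw_mon_zero_exp:
  assumes "ring A" "\<forall>i<n. \<alpha> i = 0"
  shows "pbw_mon A x n \<alpha> = \<one>\<^bsub>A\<^esub>"
proof -
  interpret ring A by fact
  show ?thesis using assms(2) by (induction n) auto
qed

lemma pbw_mon_single_exp:
  assumes "ring A" "i < n" "x i \<in> carrier A"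
  shows "pbw_mon A x n ((\<lambda>_. 0)(i := 1)) = x i"
proof -
  interpret ring A by fact
  show ?thesis using assms(2)
  proof (induction n)
    case (Suc n)
    show ?case
    proof (cases "i = n")
      case True
      then show ?thesis using assms(3) pbw_mon_zero_exp[OF assms(1), of n "(\<lambda>_. 0)(i := 1)" x]
        by (simp add: fun_upd_def)
    next
      case False
      then show ?thesis using Suc assms(3) by simp
    qed
  qed simp
qed

context skew_PBW_extension
begin

lemma R_closed [simp]: "r \<in> R \<Longrightarrow> r \<in> carrier A"
  using subring_R subringE(1) by blast

lemma coeff_zero:
  assumes "i < n" "c \<in> R" "d \<in> R" "c \<otimes> x i \<oplus> d = \<zero>"
  shows "c = \<zero> \<and> d = \<zero>"
proof -
  define e where "e = (\<lambda>_::nat. 0::nat)(i := 1)"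
  define z where "z = (\<lambda>_::nat. 0::nat)"
  have ne: "e \<noteq> z" by (auto simp: e_def z_def fun_eq_iff)
  have I: "{e, z} \<subseteq> multi_exps n" using assms(1) by (auto simp: e_def z_def multi_exps_def)
  have m: "pbw_mon A x n e = x i" "pbw_mon A x n z = \<one>"
    using pbw_mon_single_exp[where x = x, OF ring_axioms assms(1) x_closed[OF assms(1)]]
      pbw_mon_zero_exp[OF ring_axioms, of n z x] by (auto simp: e_def z_def)
  let ?c = "\<lambda>\<alpha>. if \<alpha> = e then c else d"
  have "(\<Oplus>\<alpha>\<in>{e, z}. ?c \<alpha> \<otimes> pbw_mon A x n \<alpha>) = c \<otimes> x i \<oplus> d"
    using ne assms x_closed m by (subst finsum_insert) (auto simp: Pi_def)
  moreover have "\<And>F c. \<lbrakk>finite F; F \<subseteq> multi_exps n; c ` F \<subseteq> R;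
      (\<Oplus>\<alpha>\<in>F. c \<alpha> \<otimes> pbw_mon A x n \<alpha>) = \<zero>\<rbrakk> \<Longrightarrow> \<forall>\<alpha>\<in>F. c \<alpha> = \<zero>"
    using basis unfolding free_left_basis_def by blast
  from this[of "{e, z}" ?c] have "?c ` {e, z} \<subseteq> R \<Longrightarrow>
      (\<Oplus>\<alpha>\<in>{e, z}. ?c \<alpha> \<otimes> pbw_mon A x n \<alpha>) = \<zero> \<Longrightarrow> \<forall>\<alpha>\<in>{e, z}. ?c \<alpha> = \<zero>"
    using I by blast
  ultimately have "\<forall>\<alpha>\<in>{e, z}. ?c \<alpha> = \<zero>" using assms by auto
  then show ?thesis using ne by auto
qed

lemma coeff_unique:
  assumes "i < n" "c \<in> R" "d \<in> R" "c' \<in> R" "d' \<in> R" "c \<otimes> x i \<oplus> d = c' \<otimes> x i \<oplus> d'"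
  shows "c = c' \<and> d = d'"
proof -
  have cl: "c \<in> carrier A" "d \<in> carrier A" "c' \<in> carrier A" "d' \<in> carrier A" "x i \<in> carrier A"
    using assms x_closed by auto
  have "(c \<ominus> c') \<otimes> x i \<oplus> (d \<ominus> d') = (c \<otimes> x i \<oplus> d) \<ominus> (c' \<otimes> x i \<oplus> d')"
    using cl by algebra
  also have "\<dots> = \<zero>" using assms(6) cl by (simp add: r_neg minus_eq)
  finally have "c \<ominus> c' = \<zero> \<and> d \<ominus> d' = \<zero>"
    using assms subring_R by (intro coeff_zero) (auto simp: minus_eq intro: subringE(5,7))
  then show ?thesis using cl by simp
qed

lemma skew_PBW_maps_unique:
  assumes "skew_PBW_maps A R n x \<sigma> \<delta>" "skew_PBW_maps A R n x \<sigma>' \<delta>'" "i < n" "r \<in> R"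
  shows "\<sigma> i r = \<sigma>' i r \<and> \<delta> i r = \<delta>' i r"
proof (rule coeff_unique[OF assms(3)])
  show "\<sigma> i r \<otimes> x i \<oplus> \<delta> i r = \<sigma>' i r \<otimes> x i \<oplus> \<delta>' i r"
    using assms unfolding skew_PBW_maps_def by metis
qed (use assms in \<open>auto simp: skew_PBW_maps_def skew_derivation_def ring_hom_def Pi_def\<close>)

lemma skew_PBW_maps_exist: "\<exists>\<sigma> \<delta>. skew_PBW_maps A R n x \<sigma> \<delta>"
proof -
  note sub = subringE[OF subring_R]
  have "\<exists>c d. c \<in> R \<and> d \<in> R \<and> x i \<otimes> r = c \<otimes> x i \<oplus> d \<and> (r \<noteq> \<zero> \<longrightarrow> c \<noteq> \<zero>)"
    if i: "i < n" and r: "r \<in> R" for i r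
  proof (cases "r = \<zero>")
    case True
    then show ?thesis using i x_closed sub(2) by (intro exI[of _ \<zero>]) auto
  next
    case False
    then obtain c where c: "c \<in> R - {\<zero>}" "x i \<otimes> r \<ominus> c \<otimes> x i \<in> R" using x_scalar i r by blast
    have cl: "x i \<in> carrier A" "c \<in> carrier A" "r \<in> carrier A" using x_closed i r c by auto
    have "x i \<otimes> r = c \<otimes> x i \<oplus> (x i \<otimes> r \<ominus> c \<otimes> x i)" using cl by algebra
    then show ?thesis using c by blast
  qed
  then obtain \<sigma> \<delta> where *: "\<And>i r. i < n \<Longrightarrow> r \<in> R \<Longrightarrow> \<sigma> i r \<in> R \<and> \<delta> i r \<in> R \<and>
      x i \<otimes> r = \<sigma> i r \<otimes> x i \<oplus> \<delta> i r \<and> (r \<noteq> \<zero> \<longrightarrow> \<sigma> i r \<noteq> \<zero>)"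
    by metis
  have add: "\<sigma> i (r \<oplus> s) = \<sigma> i r \<oplus> \<sigma> i s \<and> \<delta> i (r \<oplus> s) = \<delta> i r \<oplus> \<delta> i s"
    if i: "i < n" and r: "r \<in> R" and s: "s \<in> R" for i r s
  proof (rule coeff_unique[OF i])
    have cl: "x i \<in> carrier A" "r \<in> carrier A" "s \<in> carrier A" "\<sigma> i r \<in> carrier A"
      "\<sigma> i s \<in> carrier A" "\<delta> i r \<in> carrier A" "\<delta> i s \<in> carrier A"
      using x_closed i r s * by auto
    have "\<sigma> i (r \<oplus> s) \<otimes> x i \<oplus> \<delta> i (r \<oplus> s) = x i \<otimes> r \<oplus> x i \<otimes> s"
      using *[OF i sub(7)[OF r s]] cl by (simp add: r_distr)
    also have "\<dots> = (\<sigma> i r \<otimes> x i \<oplus> \<delta> i r) \<oplus> (\<sigma> i s \<otimes> x i \<oplus> \<delta> i s)"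
      using * i r s by simp
    also have "\<dots> = (\<sigma> i r \<oplus> \<sigma> i s) \<otimes> x i \<oplus> (\<delta> i r \<oplus> \<delta> i s)" using cl by algebra
    finally show "\<sigma> i (r \<oplus> s) \<otimes> x i \<oplus> \<delta> i (r \<oplus> s)
        = (\<sigma> i r \<oplus> \<sigma> i s) \<otimes> x i \<oplus> (\<delta> i r \<oplus> \<delta> i s)" .
  qed (use * i r s sub(7) in auto)
  have mult: "\<sigma> i (r \<otimes> s) = \<sigma> i r \<otimes> \<sigma> i s \<and> \<delta> i (r \<otimes> s) = \<sigma> i r \<otimes> \<delta> i s \<oplus> \<delta> i r \<otimes> s"
    if i: "i < n" and r: "r \<in> R" and s: "s \<in> R" for i r s
  proof (rule coeff_unique[OF i])
    have cl: "x i \<in> carrier A" "r \<in> carrier A" "s \<in> carrier A" "\<sigma> i r \<in> carrier A"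
      "\<sigma> i s \<in> carrier A" "\<delta> i r \<in> carrier A" "\<delta> i s \<in> carrier A"
      using x_closed i r s * by auto
    have "\<sigma> i (r \<otimes> s) \<otimes> x i \<oplus> \<delta> i (r \<otimes> s) = (x i \<otimes> r) \<otimes> s"
      using *[OF i sub(6)[OF r s]] cl by (simp add: m_assoc)
    also have "\<dots> = \<sigma> i r \<otimes> (x i \<otimes> s) \<oplus> \<delta> i r \<otimes> s"
      using *[OF i r] cl by (simp add: l_distr m_assoc)
    also have "\<dots> = \<sigma> i r \<otimes> (\<sigma> i s \<otimes> x i \<oplus> \<delta> i s) \<oplus> \<delta> i r \<otimes> s"
      using *[OF i s] by simp
    also have "\<dots> = (\<sigma> i r \<otimes> \<sigma> i s) \<otimes> x i \<oplus> (\<sigma> i r \<otimes> \<delta> i s \<oplus> \<delta> i r \<otimes> s)"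
      using cl by (simp add: r_distr m_assoc a_assoc)
    finally show "\<sigma> i (r \<otimes> s) \<otimes> x i \<oplus> \<delta> i (r \<otimes> s)
        = (\<sigma> i r \<otimes> \<sigma> i s) \<otimes> x i \<oplus> (\<sigma> i r \<otimes> \<delta> i s \<oplus> \<delta> i r \<otimes> s)" .
  qed (use * i r s sub(6,7) in auto)
  have one: "\<sigma> i \<one> = \<one>" if i: "i < n" for i
    using coeff_unique[OF i, of "\<sigma> i \<one>" "\<delta> i \<one>" \<one> \<zero>] *[OF i sub(3)] sub(2,3) x_closed[OF i]
    by simp
  have inj: "inj_on (\<sigma> i) R" if i: "i < n" for i
  proof (rule inj_onI)
    fix r s assume rs: "r \<in> R" "s \<in> R" "\<sigma> i r = \<sigma> i s"
    have d: "r \<ominus> s \<in> R" using rs sub(5,7) by (simp add: minus_eq)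
    have "\<sigma> i r = \<sigma> i ((r \<ominus> s) \<oplus> s)" using rs by (simp add: minus_eq a_assoc l_neg)
    also have "\<dots> = \<sigma> i (r \<ominus> s) \<oplus> \<sigma> i s" using add[OF i d] rs by simp
    finally have "\<sigma> i (r \<ominus> s) = \<zero>"
      using rs * i d by (metis R_closed add.l_cancel_one' a_comm)
    then have "r \<ominus> s = \<zero>" using * i d by blast
    then show "r = s" using rs by simp
  qed
  have "skew_PBW_maps A R n x \<sigma> \<delta>"
    unfolding skew_PBW_maps_def skew_derivation_def ring_hom_def
    using * add mult one inj by (simp add: Pi_def)
  then show ?thesis by blast
qed

end

end

theory Submission
  imports Defs "HOL-Library.Fun_Lexorder"
begin

text \<open>
  Write \<open>N\<close> for the set of nilpotent elements of \<open>R\<close>. The hypothesis on weak annihilators in \<open>R\<close> is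
  strong enough to determine all of them. For \<open>p = 1\<close>, which is not nilpotent unless \<open>A\<close> is the zero
  ring, it gives \<open>N = cR\<close> with \<open>c\<close> nilpotent. For an arbitrary non-nilpotent \<open>p\<close>, the weak
  annihilator of \<open>p\<close> contains the ideal \<open>N\<close>, and having a nilpotent generator it is contained in
  \<open>N\<close>; so \<open>pq \<in> N\<close> forces \<open>q \<in> N\<close>. In other words, \<open>N\<close> is a
  completely prime ideal of \<open>R\<close> with a nilpotent right generator (\<open>nilpotents_prime_principal\<close>).

  Let \<open>P\<close> be the set of elements of \<open>A\<close> all of whose coefficients lie in \<open>N\<close>. Then \<open>P = cA\<close>
  (\<open>coefs_in_N_principal\<close>), and the theorem follows once \<open>P\<close> is seen to be the set of nilpotent
  elements of \<open>A\<close> and to be completely prime: for \<open>f\<close> outside \<open>P\<close>, \<open>fa\<close> is nilpotent exactly when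
  \<open>a \<in> P\<close>, so every weak annihilator in question equals \<open>cA\<close>.

  \<^item> The elements of \<open>P\<close> are nilpotent. The ideal \<open>N\<close> is stable under \<open>\<sigma>\<^sub>i\<close> and, by compatibility,
    under \<open>\<delta>\<^sub>i\<close> (\<open>d_nilpotents\<close>), hence \<open>x\<^sub>i c \<in> cA\<close>, hence \<open>Ac \<subseteq> cA\<close> (\<open>left_mult_principal\<close>).
    Moving all factors \<open>c\<close> to the left shows \<open>(ch)\<^sup>k \<in> c\<^sup>k A\<close> (\<open>nilpotent_right_multiple\<close>). For a
    general NI ring, nilpotent coefficients need not make an element of \<open>A\<close> nilpotent: by
    Smoktunowicz there are nil rings with a non-nil polynomial ring. It is the single nilpotent
    generator \<open>c\<close> that makes the step work.

  \<^item> \<open>P\<close> is completely prime (\<open>coefs_in_N_prime\<close>). Modulo \<open>N\<close> the coefficients form a domain on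
    which each \<open>\<sigma>\<^sub>i\<close> is injective, and the coefficients \<open>d\<close> in \<open>x\<^sub>i x\<^sub>j = d x\<^sub>j x\<^sub>i + \<dots>\<close> do not vanish,
    because exchanging the two variables twice shows that they have a one-sided inverse. Hence leading
    terms for the degree-lexicographic order multiply without cancellation.

  A power of \<open>f\<close> that vanishes lies in \<open>P\<close>, so complete primeness also shows that the nilpotent
  elements of \<open>A\<close> lie in \<open>P\<close> (\<open>nilpotents_principal\<close>).
\<close>

section \<open>Nilpotent elements of the coefficient ring\<close>

context ring
begin

lemma upper_nilradicalI:
  assumes "finite F" "\<And>I. I \<in> F \<Longrightarrow> nil_ideal I R" "\<And>I. I \<in> F \<Longrightarrow> a I \<in> I"
  shows "(\<Oplus>I\<in>F. a I) \<in> upper_nilradical R"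
  using assms unfolding upper_nilradical_def by blast

lemma upper_nilradicalE:
  assumes "y \<in> upper_nilradical R"
  obtains F a where "finite F"
    "\<forall>I\<in>F. ideal I R \<and> nil_ideal I R \<and> a I \<in> I \<and> a I \<in> carrier R" "y = (\<Oplus>I\<in>F. a I)"
proof -
  obtain F a where *: "finite F" "\<forall>I\<in>F. nil_ideal I R \<and> a I \<in> I" "y = (\<Oplus>I\<in>F. a I)"
    using assms unfolding upper_nilradical_def by blast
  moreover have "ideal I R" "a I \<in> carrier R" if "I \<in> F" for I
    using * that unfolding nil_ideal_def by (auto intro: ideal.Icarr)
  ultimately show thesis using that by blast
qed

text \<open>
  The sum of two finite sums is brought over a common index set of nil ideals by padding with zeros.
\<close>

lemma ideal_upper_nilradical: "ideal (upper_nilradical R) R"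
proof -
  let ?N = "upper_nilradical R"
  have closed: "?N \<subseteq> carrier R"
    by (auto elim!: upper_nilradicalE intro!: finsum_closed simp: Pi_def)
  have zero: "\<zero> \<in> ?N" using upper_nilradicalI[of "{}" "\<lambda>_. \<zero>"] by simp
  have add: "y \<oplus> z \<in> ?N" if y: "y \<in> ?N" and z: "z \<in> ?N" for y z
  proof -
    from y obtain F a where "finite F"
      "\<forall>I\<in>F. ideal I R \<and> nil_ideal I R \<and> a I \<in> I \<and> a I \<in> carrier R" "y = (\<Oplus>I\<in>F. a I)"
      by (rule upper_nilradicalE)
    then have F: "finite F" "\<And>I. I \<in> F \<Longrightarrow> ideal I R" "\<And>I. I \<in> F \<Longrightarrow> nil_ideal I R"
      "\<And>I. I \<in> F \<Longrightarrow> a I \<in> I" "\<And>I. I \<in> F \<Longrightarrow> a I \<in> carrier R" "y = (\<Oplus>I\<in>F. a I)"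
      by simp_all
    from z obtain G b where "finite G"
      "\<forall>I\<in>G. ideal I R \<and> nil_ideal I R \<and> b I \<in> I \<and> b I \<in> carrier R" "z = (\<Oplus>I\<in>G. b I)"
      by (rule upper_nilradicalE)
    then have G: "finite G" "\<And>I. I \<in> G \<Longrightarrow> ideal I R" "\<And>I. I \<in> G \<Longrightarrow> nil_ideal I R"
      "\<And>I. I \<in> G \<Longrightarrow> b I \<in> I" "\<And>I. I \<in> G \<Longrightarrow> b I \<in> carrier R" "z = (\<Oplus>I\<in>G. b I)"
      by simp_all
    define a' where "a' = (\<lambda>I. if I \<in> F then a I else \<zero>)"
    define b' where "b' = (\<lambda>I. if I \<in> G then b I else \<zero>)"
    have cl: "a' I \<in> carrier R" "b' I \<in> carrier R" for I
      using F(5) G(5) by (simp_all add: a'_def b'_def)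
    have "y = (\<Oplus>I\<in>F \<union> G. a' I)"
      unfolding F(6) using F(1,5) G(1) by (intro add.finprod_mono_neutral_cong_left) (auto simp: a'_def)
    moreover have "z = (\<Oplus>I\<in>F \<union> G. b' I)"
      unfolding G(6) using F(1) G(1,5) by (intro add.finprod_mono_neutral_cong_left) (auto simp: b'_def)
    ultimately have "y \<oplus> z = (\<Oplus>I\<in>F \<union> G. a' I \<oplus> b' I)"
      using cl by (simp add: finsum_addf)
    moreover have "(\<Oplus>I\<in>F \<union> G. a' I \<oplus> b' I) \<in> ?N"
    proof (rule upper_nilradicalI)
      fix I assume I: "I \<in> F \<union> G"
      then have "ideal I R" using F(2) G(2) by blast
      then interpret I: ideal I R .
      show "nil_ideal I R" using I F(3) G(3) by blast
      show "a' I \<oplus> b' I \<in> I" using F(4) G(4) by (auto simp: a'_def b'_def)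
    qed (use F(1) G(1) in simp)
    ultimately show ?thesis by simp
  qed
  have mult: "r \<otimes> y \<in> ?N \<and> y \<otimes> r \<in> ?N" if y: "y \<in> ?N" and r: "r \<in> carrier R" for y r
  proof -
    from y obtain F a where "finite F"
      "\<forall>I\<in>F. ideal I R \<and> nil_ideal I R \<and> a I \<in> I \<and> a I \<in> carrier R" "y = (\<Oplus>I\<in>F. a I)"
      by (rule upper_nilradicalE)
    then have F: "finite F" "\<And>I. I \<in> F \<Longrightarrow> ideal I R" "\<And>I. I \<in> F \<Longrightarrow> nil_ideal I R"
      "\<And>I. I \<in> F \<Longrightarrow> a I \<in> I" "\<And>I. I \<in> F \<Longrightarrow> a I \<in> carrier R" "y = (\<Oplus>I\<in>F. a I)"
      by simp_all
    have "r \<otimes> y = (\<Oplus>I\<in>F. r \<otimes> a I)" "y \<otimes> r = (\<Oplus>I\<in>F. a I \<otimes> r)"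
      unfolding F(6) using F(1,5) r by (auto intro!: finsum_rdistr finsum_ldistr)
    moreover have "(\<Oplus>I\<in>F. r \<otimes> a I) \<in> ?N" "(\<Oplus>I\<in>F. a I \<otimes> r) \<in> ?N"
      using F(1,3) ideal.I_l_closed[OF F(2) F(4) r] ideal.I_r_closed[OF F(2) F(4) r]
      by (auto intro!: upper_nilradicalI)
    ultimately show ?thesis by simp
  qed
  show ?thesis
  proof (rule idealI)
    show "ring R" by (rule ring_axioms)
    show "subgroup ?N (add_monoid R)"
    proof (rule add.subgroupI)
      fix y assume y: "y \<in> ?N"
      \<comment> \<open>Negation is multiplication by \<open>-1\<close>, so closure under multiplication suffices.\<close>
      have "(\<ominus> \<one>) \<otimes> y \<in> ?N" using mult[OF y] by simp
      moreover have "(\<ominus> \<one>) \<otimes> y = \<ominus> y" using y closed by (simp add: l_minus subset_iff)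
      ultimately show "\<ominus> y \<in> ?N" by simp
    qed (use zero closed add in auto)
  qed (use mult in auto)
qed

lemma nilpotentsI: "a \<in> carrier R \<Longrightarrow> a [^] (k::nat) = \<zero> \<Longrightarrow> a \<in> nilpotents R"
  unfolding nilpotents_def by blast

lemma NI_nilpotents_ideal: "NI_ring R \<Longrightarrow> ideal (nilpotents R) R"
  using ideal_upper_nilradical by (simp add: NI_ring_def)

lemma weak_annihilator_single:
  "weak_annihilator R {p} = {a \<in> carrier R. p \<otimes> a \<in> nilpotents R}"
  by (simp add: weak_annihilator_def)

text \<open>
  The weak annihilator of a non-nilpotent \<open>p\<close> contains the ideal of nilpotent elements, and is
  contained in it because its generator is nilpotent; that the two agree is complete primeness. The
  generator \<open>c\<close> comes from \<open>p = 1\<close>.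
\<close>

lemma nilpotents_prime_principal:
  assumes NI: "NI_ring R" and one: "\<one> \<notin> nilpotents R"
    and gen: "\<And>p. p \<in> carrier R \<Longrightarrow> p \<notin> nilpotents R \<Longrightarrow>
      nilpotently_generated R (weak_annihilator R {p})"
  obtains c where "c \<in> nilpotents R" "nilpotents R = {c \<otimes> s | s. s \<in> carrier R}"
    "\<And>p q. p \<in> carrier R \<Longrightarrow> q \<in> carrier R \<Longrightarrow> p \<otimes> q \<in> nilpotents R \<Longrightarrow>
      p \<in> nilpotents R \<or> q \<in> nilpotents R"
proof -
  interpret N: ideal "nilpotents R" R using NI_nilpotents_ideal[OF NI] .
  have "weak_annihilator R {\<one>} = nilpotents R"
    using N.Icarr by (auto simp: weak_annihilator_single)
  then have "nilpotently_generated R (nilpotents R)"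
    using gen[OF one_closed one] by simp
  then obtain c where c: "c \<in> nilpotents R" "nilpotents R = {c \<otimes> s | s. s \<in> carrier R}"
    unfolding nilpotently_generated_def by (rule bexE)
  have prime: "q \<in> nilpotents R"
    if p: "p \<in> carrier R" "p \<notin> nilpotents R" and q: "q \<in> carrier R" "p \<otimes> q \<in> nilpotents R" for p q
  proof -
    obtain d where d: "d \<in> nilpotents R" "weak_annihilator R {p} = {d \<otimes> s | s. s \<in> carrier R}"
      using gen[OF p] unfolding nilpotently_generated_def by blast
    have "q \<in> weak_annihilator R {p}" using q by (simp add: weak_annihilator_single)
    then show ?thesis using d N.I_r_closed by auto
  qed
  show thesis using that[OF c] prime by blast
qed

lemma nilpotents_inj_hom:
  assumes s: "s \<in> ring_hom R R" "inj_on s (carrier R)" and r: "r \<in> carrier R"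
  shows "s r \<in> nilpotents R \<longleftrightarrow> r \<in> nilpotents R"
proof -
  interpret s: ring_hom_ring R R s
    using s(1) ring_axioms by (intro ring_hom_ringI2)
  have "s r [^] k = \<zero> \<longleftrightarrow> r [^] k = \<zero>" for k :: nat
    using s.hom_nat_pow[OF r, of k] s(2) r
    by (metis inj_on_contraD nat_pow_closed s.hom_zero zero_closed)
  then show ?thesis using r by (simp add: nilpotents_def)
qed

text \<open>
  Each \<open>c\<close> in \<open>(ch)(ch)\<dots>(ch)\<close> can be moved to the far left, so \<open>(ch)\<^sup>k \<in> c\<^sup>k R\<close>.
\<close>

lemma nilpotent_right_multiple:
  assumes c: "c \<in> nilpotents R" and h: "h \<in> carrier R"
    and move: "\<And>a. a \<in> carrier R \<Longrightarrow> \<exists>b\<in>carrier R. a \<otimes> c = c \<otimes> b"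
  shows "c \<otimes> h \<in> nilpotents R"
proof -
  obtain k :: nat where cl: "c \<in> carrier R" and k: "c [^] k = \<zero>"
    using c unfolding nilpotents_def by blast
  have "\<exists>b\<in>carrier R. (c \<otimes> h) [^] m = c [^] m \<otimes> b" for m :: nat
  proof (induction m)
    case (Suc m)
    then obtain b where b: "b \<in> carrier R" "(c \<otimes> h) [^] m = c [^] m \<otimes> b" by blast
    obtain b' where b': "b' \<in> carrier R" "b \<otimes> c = c \<otimes> b'" using move[OF b(1)] by blast
    have "(c \<otimes> h) [^] Suc m = c [^] m \<otimes> (b \<otimes> c) \<otimes> h"
      using b cl h by (simp add: m_assoc)
    also have "\<dots> = c [^] Suc m \<otimes> (b' \<otimes> h)" using b' cl h by (simp add: m_assoc)
    finally show ?case using b'(1) h by (intro bexI[of _ "b' \<otimes> h"]) auto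
  qed (use cl in auto)
  then obtain b where "b \<in> carrier R" "(c \<otimes> h) [^] k = c [^] k \<otimes> b" by blast
  then have "(c \<otimes> h) [^] k = \<zero>" by (simp add: k)
  then show ?thesis using cl h by (intro nilpotentsI) auto
qed

end

text \<open>
  Compatibility for a single pair \<open>(\<sigma>\<^sub>i, \<delta>\<^sub>i)\<close>: the instance of \<open>(\<Sigma>, \<Delta>)\<close>-compatibility for exponents
  of degree one.
\<close>

locale compatible_skew_derivation = ring R for R (structure) +
  fixes s d :: "'a \<Rightarrow> 'a"
  assumes hom: "s \<in> ring_hom R R"
    and der: "skew_derivation R s d"
    and s_compat: "\<And>a b. a \<in> carrier R \<Longrightarrow> b \<in> carrier R \<Longrightarrow> a \<otimes> s b = \<zero> \<longleftrightarrow> a \<otimes> b = \<zero>"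
    and d_compat: "\<And>a b. a \<in> carrier R \<Longrightarrow> b \<in> carrier R \<Longrightarrow> a \<otimes> b = \<zero> \<Longrightarrow> a \<otimes> d b = \<zero>"
begin

lemma d_closed: "a \<in> carrier R \<Longrightarrow> d a \<in> carrier R"
  using der unfolding skew_derivation_def by blast

lemma d_mult:
  "a \<in> carrier R \<Longrightarrow> b \<in> carrier R \<Longrightarrow> d (a \<otimes> b) = s a \<otimes> d b \<oplus> d a \<otimes> b"
  using der unfolding skew_derivation_def by blast

text \<open>
  Apply \<open>d\<close> to the right factor of \<open>u \<cdot> bv = 0\<close> and expand: the unwanted summand \<open>u s(b) d(v)\<close>
  vanishes, since \<open>ub \<cdot> v = 0\<close> yields \<open>ub d(v) = 0\<close>, and compatibility with \<open>s\<close> allows one to insert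
  \<open>s\<close> on \<open>b d(v)\<close> and then to remove it from \<open>d(v)\<close>.
\<close>

lemma product_zero_replace:
  assumes u: "u \<in> carrier R" and b: "b \<in> carrier R" and v: "v \<in> carrier R"
    and z: "u \<otimes> b \<otimes> v = \<zero>"
  shows "u \<otimes> d b \<otimes> v = \<zero>"
proof -
  have cl: "s b \<in> carrier R" "s (d v) \<in> carrier R" "d b \<in> carrier R" "d v \<in> carrier R"
    using b v hom d_closed by (auto simp: ring_hom_def)
  have "u \<otimes> b \<otimes> d v = \<zero>" using d_compat[of "u \<otimes> b" v] u b v z by simp
  then have "u \<otimes> s (b \<otimes> d v) = \<zero>"
    using s_compat[of u "b \<otimes> d v"] u b cl by (simp add: m_assoc)
  then have "(u \<otimes> s b) \<otimes> s (d v) = \<zero>"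
    using hom u b cl by (simp add: ring_hom_mult m_assoc)
  then have 1: "u \<otimes> (s b \<otimes> d v) = \<zero>"
    using s_compat[of "u \<otimes> s b" "d v"] u cl by (simp add: m_assoc)
  have "u \<otimes> d (b \<otimes> v) = \<zero>" using d_compat[of u "b \<otimes> v"] u b v z by (simp add: m_assoc)
  then have "u \<otimes> (s b \<otimes> d v) \<oplus> u \<otimes> (d b \<otimes> v) = \<zero>"
    using u b v cl by (simp add: d_mult r_distr)
  then show ?thesis using 1 u v cl by (simp add: m_assoc)
qed

text \<open>
  In \<open>b \<cdot> b \<cdots> b = 0\<close> the factors are replaced by \<open>d b\<close> one at a time, from left to right.
\<close>

lemma d_nilpotents:
  assumes "b \<in> nilpotents R"
  shows "d b \<in> nilpotents R"
proof -
  obtain k :: nat where b: "b \<in> carrier R" and k: "b [^] k = \<zero>"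
    using assms unfolding nilpotents_def by blast
  have db: "d b \<in> carrier R" using b by (rule d_closed)
  have "d b [^] j \<otimes> b [^] m = \<zero>" if "j + m = k" for j m
    using that
  proof (induction j arbitrary: m)
    case 0
    then show ?case using b k by simp
  next
    case (Suc j)
    have "d b [^] j \<otimes> b [^] Suc m = \<zero>"
      using Suc.IH[of "Suc m"] Suc.prems by (simp del: nat_pow_Suc)
    then have "d b [^] j \<otimes> b \<otimes> b [^] m = \<zero>"
      using b db nat_pow_Suc2[OF b, of m] by (simp add: m_assoc del: nat_pow_Suc)
    then have "d b [^] j \<otimes> d b \<otimes> b [^] m = \<zero>"
      using b db by (intro product_zero_replace) auto
    then show ?case by simp
  qed
  from this[of k 0] have "d b [^] k = \<zero>" using db by simp
  with db show ?thesis by (rule nilpotentsI)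
qed

end

lemma multi_comp_zero_exp: "\<forall>i<n. \<alpha> i = 0 \<Longrightarrow> multi_comp f n \<alpha> = id"
  by (induction n) auto

lemma multi_comp_single_exp: "i < n \<Longrightarrow> multi_comp f n ((\<lambda>_. 0)(i := 1)) = f i"
proof (induction n)
  case (Suc n)
  then show ?case by (cases "i = n") (auto simp: multi_comp_zero_exp)
qed simp

lemma Sigma_compatible_single:
  assumes "Sigma_compatible S n s" "i < n" "a \<in> carrier S" "b \<in> carrier S"
  shows "a \<otimes>\<^bsub>S\<^esub> s i b = \<zero>\<^bsub>S\<^esub> \<longleftrightarrow> a \<otimes>\<^bsub>S\<^esub> b = \<zero>\<^bsub>S\<^esub>"
proof -
  have "(\<lambda>_. 0)(i := 1) \<in> multi_exps n" using assms(2) by (simp add: multi_exps_def)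
  then show ?thesis
    using assms multi_comp_single_exp[OF assms(2), of s] unfolding Sigma_compatible_def by metis
qed

lemma Delta_compatible_single:
  assumes "Delta_compatible S n d" "i < n" "a \<in> carrier S" "b \<in> carrier S"
    and "a \<otimes>\<^bsub>S\<^esub> b = \<zero>\<^bsub>S\<^esub>"
  shows "a \<otimes>\<^bsub>S\<^esub> d i b = \<zero>\<^bsub>S\<^esub>"
proof -
  have "(\<lambda>_. 0)(i := 1) \<in> multi_exps n" using assms(2) by (simp add: multi_exps_def)
  then show ?thesis
    using assms multi_comp_single_exp[OF assms(2), of d] unfolding Delta_compatible_def by metis
qed

section \<open>Coefficients with respect to the monomial basis\<close>

context skew_PBW_extension
begin

abbreviation mon :: "(nat \<Rightarrow> nat) \<Rightarrow> 'a" where "mon \<equiv> pbw_mon A x n"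

lemma pbw_mon_closed: "k \<le> n \<Longrightarrow> pbw_mon A x k \<alpha> \<in> carrier A"
  by (induction k) (simp_all add: x_closed)

lemma mon_closed [simp]: "mon \<alpha> \<in> carrier A"
  by (simp add: pbw_mon_closed)

lemma expansion_unique:
  assumes "finite F" "F \<subseteq> multi_exps n" "c ` F \<subseteq> R" "d ` F \<subseteq> R"
    and "(\<Oplus>\<alpha>\<in>F. c \<alpha> \<otimes> mon \<alpha>) = (\<Oplus>\<alpha>\<in>F. d \<alpha> \<otimes> mon \<alpha>)"
  shows "\<forall>\<alpha>\<in>F. c \<alpha> = d \<alpha>"
proof -
  have cl: "\<And>\<alpha>. \<alpha> \<in> F \<Longrightarrow> c \<alpha> \<in> carrier A" "\<And>\<alpha>. \<alpha> \<in> F \<Longrightarrow> d \<alpha> \<in> carrier A"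
    using assms R_closed by blast+
  have dR: "(\<lambda>\<alpha>. c \<alpha> \<ominus> d \<alpha>) ` F \<subseteq> R"
    using assms(3,4) subringE(5,7)[OF subring_R] by (auto simp: minus_eq image_subset_iff)
  have "(\<Oplus>\<alpha>\<in>F. (c \<alpha> \<ominus> d \<alpha>) \<otimes> mon \<alpha>) \<oplus> (\<Oplus>\<alpha>\<in>F. d \<alpha> \<otimes> mon \<alpha>)
      = (\<Oplus>\<alpha>\<in>F. (c \<alpha> \<ominus> d \<alpha>) \<otimes> mon \<alpha> \<oplus> d \<alpha> \<otimes> mon \<alpha>)"
    using cl by (subst finsum_addf) (auto simp: Pi_def)
  also have "\<dots> = (\<Oplus>\<alpha>\<in>F. c \<alpha> \<otimes> mon \<alpha>)"
    using cl by (intro finsum_cong') (auto simp: Pi_def minus_eq l_distr a_assoc l_minus l_neg)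
  finally have "(\<Oplus>\<alpha>\<in>F. (c \<alpha> \<ominus> d \<alpha>) \<otimes> mon \<alpha>) = \<zero>"
    using cl assms(5) by (simp add: Pi_def)
  then have "\<forall>\<alpha>\<in>F. c \<alpha> \<ominus> d \<alpha> = \<zero>"
    using basis dR assms(1,2) unfolding free_left_basis_def by blast
  then show ?thesis using cl by simp
qed

definition is_expansion :: "'a \<Rightarrow> ((nat \<Rightarrow> nat) \<Rightarrow> 'a) \<Rightarrow> bool" where
  "is_expansion f c \<longleftrightarrow> range c \<subseteq> R \<and> finite {\<alpha>. c \<alpha> \<noteq> \<zero>} \<and> {\<alpha>. c \<alpha> \<noteq> \<zero>} \<subseteq> multi_exps n \<and>
     f = (\<Oplus>\<alpha>\<in>{\<alpha>. c \<alpha> \<noteq> \<zero>}. c \<alpha> \<otimes> mon \<alpha>)"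

lemma is_expansionD:
  assumes "is_expansion f c"
  shows "c \<alpha> \<in> R" "finite {\<alpha>. c \<alpha> \<noteq> \<zero>}" "\<alpha> \<notin> multi_exps n \<Longrightarrow> c \<alpha> = \<zero>"
  using assms unfolding is_expansion_def by blast+

text \<open>
  Meaningful for elements of the carrier only; there the expansion exists and is unique.
\<close>

definition coef :: "'a \<Rightarrow> (nat \<Rightarrow> nat) \<Rightarrow> 'a" where
  "coef f = (SOME c. is_expansion f c)"

lemma finsum_support:
  assumes "range c \<subseteq> R" "finite F" "{\<alpha>. c \<alpha> \<noteq> \<zero>} \<subseteq> F"
  shows "(\<Oplus>\<alpha>\<in>{\<alpha>. c \<alpha> \<noteq> \<zero>}. c \<alpha> \<otimes> mon \<alpha>) = (\<Oplus>\<alpha>\<in>F. c \<alpha> \<otimes> mon \<alpha>)"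
proof -
  have cl: "c \<alpha> \<in> carrier A" for \<alpha> using assms(1) by (simp add: image_subset_iff)
  show ?thesis
  proof (rule add.finprod_mono_neutral_cong_left)
    show "c \<alpha> \<otimes> mon \<alpha> = \<zero>" if "\<alpha> \<in> F - {\<alpha>. c \<alpha> \<noteq> \<zero>}" for \<alpha>
      using that by simp
    show "(\<lambda>\<alpha>. c \<alpha> \<otimes> mon \<alpha>) \<in> F \<rightarrow> carrier A"
      using cl by simp
  qed (use assms in simp_all)
qed

lemma is_expansion_extend:
  assumes "is_expansion f c" "finite F" "{\<alpha>. c \<alpha> \<noteq> \<zero>} \<subseteq> F"
  shows "f = (\<Oplus>\<alpha>\<in>F. c \<alpha> \<otimes> mon \<alpha>)"
proof -
  have "range c \<subseteq> R" and "f = (\<Oplus>\<alpha>\<in>{\<alpha>. c \<alpha> \<noteq> \<zero>}. c \<alpha> \<otimes> mon \<alpha>)"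
    using assms(1) unfolding is_expansion_def by blast+
  with finsum_support[OF _ assms(2,3)] show ?thesis by (simp only:)
qed

lemma is_expansionI:
  assumes "finite F" "F \<subseteq> multi_exps n" "range c \<subseteq> R" "{\<alpha>. c \<alpha> \<noteq> \<zero>} \<subseteq> F"
  shows "is_expansion (\<Oplus>\<alpha>\<in>F. c \<alpha> \<otimes> mon \<alpha>) c"
  unfolding is_expansion_def
  using assms(3) finsum_support[OF assms(3,1,4)] finite_subset[OF assms(4,1)]
    order_trans[OF assms(4,2)] by (simp only: simp_thms)

lemma is_expansion_unique:
  assumes "is_expansion f c" "is_expansion f d" shows "c = d"
proof
  fix \<alpha>
  let ?F = "{\<alpha>. c \<alpha> \<noteq> \<zero>} \<union> {\<alpha>. d \<alpha> \<noteq> \<zero>}"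
  have F: "finite ?F" "?F \<subseteq> multi_exps n" "c ` ?F \<subseteq> R" "d ` ?F \<subseteq> R"
    using is_expansionD[OF assms(1)] is_expansionD[OF assms(2)]
    by (simp_all add: image_subset_iff) blast
  have 1: "f = (\<Oplus>\<alpha>\<in>?F. c \<alpha> \<otimes> mon \<alpha>)"
    by (rule is_expansion_extend[OF assms(1) F(1) Un_upper1])
  have 2: "f = (\<Oplus>\<alpha>\<in>?F. d \<alpha> \<otimes> mon \<alpha>)"
    by (rule is_expansion_extend[OF assms(2) F(1) Un_upper2])
  have eq: "\<forall>\<alpha>\<in>?F. c \<alpha> = d \<alpha>"
    by (rule expansion_unique[OF F trans[OF 1[symmetric] 2]])
  show "c \<alpha> = d \<alpha>"
  proof (cases "\<alpha> \<in> ?F")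
    case True
    with eq show ?thesis by (rule bspec)
  next
    case False
    then show ?thesis by simp
  qed
qed

lemma coef_eqI:
  assumes "is_expansion f c"
  shows "coef f = c"
  using assms is_expansion_unique[OF _ assms] unfolding coef_def by (rule some_equality)

lemma is_expansion_coef:
  assumes "f \<in> carrier A" shows "is_expansion f (coef f)"
proof -
  obtain F c where F: "finite F" "F \<subseteq> multi_exps n" "c ` F \<subseteq> R"
    and f: "f = (\<Oplus>\<alpha>\<in>F. c \<alpha> \<otimes> mon \<alpha>)"
    using bspec[OF basis[unfolded free_left_basis_def, THEN conjunct2, THEN conjunct1] assms]
    by (elim exE conjE) simp
  let ?c = "\<lambda>\<alpha>. if \<alpha> \<in> F then c \<alpha> else \<zero>"
  have "f = (\<Oplus>\<alpha>\<in>F. ?c \<alpha> \<otimes> mon \<alpha>)"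
    unfolding f using F(3) by (intro finsum_cong') (auto simp: image_subset_iff)
  moreover have "is_expansion (\<Oplus>\<alpha>\<in>F. ?c \<alpha> \<otimes> mon \<alpha>) ?c"
    using F subringE(2)[OF subring_R] by (intro is_expansionI) auto
  ultimately have "is_expansion f ?c" by (simp only:)
  then show ?thesis unfolding coef_def by (rule someI[where P = "is_expansion f"])
qed

lemma coef_in_R: "f \<in> carrier A \<Longrightarrow> coef f \<alpha> \<in> R"
  by (rule is_expansionD(1)[OF is_expansion_coef])

lemma finite_coef: "f \<in> carrier A \<Longrightarrow> finite {\<alpha>. coef f \<alpha> \<noteq> \<zero>}"
  by (rule is_expansionD(2)[OF is_expansion_coef])

lemma coef_outside: "f \<in> carrier A \<Longrightarrow> \<alpha> \<notin> multi_exps n \<Longrightarrow> coef f \<alpha> = \<zero>"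
  by (rule is_expansionD(3)[OF is_expansion_coef])

lemma coef_add:
  assumes f: "f \<in> carrier A" and g: "g \<in> carrier A"
  shows "coef (f \<oplus> g) \<alpha> = coef f \<alpha> \<oplus> coef g \<alpha>"
proof -
  let ?F = "{\<alpha>. coef f \<alpha> \<noteq> \<zero>} \<union> {\<alpha>. coef g \<alpha> \<noteq> \<zero>}"
  let ?c = "\<lambda>\<alpha>. coef f \<alpha> \<oplus> coef g \<alpha>"
  have F: "finite ?F" "?F \<subseteq> multi_exps n"
    using f g finite_coef coef_outside by auto
  have cl: "\<And>\<alpha>. coef f \<alpha> \<in> carrier A" "\<And>\<alpha>. coef g \<alpha> \<in> carrier A"
    using f g coef_in_R by auto
  have ef: "f = (\<Oplus>\<alpha>\<in>?F. coef f \<alpha> \<otimes> mon \<alpha>)"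
    using is_expansion_coef[OF f] F(1) by (intro is_expansion_extend) auto
  have eg: "g = (\<Oplus>\<alpha>\<in>?F. coef g \<alpha> \<otimes> mon \<alpha>)"
    using is_expansion_coef[OF g] F(1) by (intro is_expansion_extend) auto
  have "(\<Oplus>\<alpha>\<in>?F. ?c \<alpha> \<otimes> mon \<alpha>) = (\<Oplus>\<alpha>\<in>?F. coef f \<alpha> \<otimes> mon \<alpha> \<oplus> coef g \<alpha> \<otimes> mon \<alpha>)"
    using cl by (intro finsum_cong') (auto simp: l_distr)
  also have "\<dots> = f \<oplus> g"
    using cl by (subst finsum_addf) (auto simp: Pi_def simp flip: ef eg)
  moreover have "is_expansion (\<Oplus>\<alpha>\<in>?F. ?c \<alpha> \<otimes> mon \<alpha>) ?c"
    using F f g coef_in_R subringE(7)[OF subring_R] by (intro is_expansionI) auto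
  ultimately have "is_expansion (f \<oplus> g) ?c" by (simp only:)
  then show ?thesis by (simp add: coef_eqI)
qed

lemma coef_smult:
  assumes r: "r \<in> R" and f: "f \<in> carrier A"
  shows "coef (r \<otimes> f) \<alpha> = r \<otimes> coef f \<alpha>"
proof -
  let ?F = "{\<alpha>. coef f \<alpha> \<noteq> \<zero>}"
  let ?c = "\<lambda>\<alpha>. r \<otimes> coef f \<alpha>"
  have F: "finite ?F" "?F \<subseteq> multi_exps n"
    using f finite_coef coef_outside by auto
  have cl: "\<And>\<alpha>. coef f \<alpha> \<in> carrier A" using f coef_in_R by auto
  have "(\<Oplus>\<alpha>\<in>?F. ?c \<alpha> \<otimes> mon \<alpha>) = (\<Oplus>\<alpha>\<in>?F. r \<otimes> (coef f \<alpha> \<otimes> mon \<alpha>))"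
    using cl r by (intro finsum_cong') (auto simp: m_assoc)
  also have "\<dots> = r \<otimes> (\<Oplus>\<alpha>\<in>?F. coef f \<alpha> \<otimes> mon \<alpha>)"
    using cl r F by (subst finsum_rdistr) auto
  also have "\<dots> = r \<otimes> f"
    using is_expansion_extend[OF is_expansion_coef[OF f] F(1)] by simp
  moreover have "is_expansion (\<Oplus>\<alpha>\<in>?F. ?c \<alpha> \<otimes> mon \<alpha>) ?c"
    using F f r coef_in_R subringE(6)[OF subring_R] by (intro is_expansionI) auto
  ultimately have "is_expansion (r \<otimes> f) ?c" by (simp only:)
  then show ?thesis by (simp add: coef_eqI)
qed

lemma coef_zero: "coef \<zero> \<alpha> = \<zero>"
  using coef_smult[of \<zero> \<zero> \<alpha>] coef_in_R[of \<zero> \<alpha>] subringE(2)[OF subring_R] by simp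

lemma coef_mon:
  assumes "\<beta> \<in> multi_exps n"
  shows "coef (mon \<beta>) \<alpha> = (if \<alpha> = \<beta> then \<one> else \<zero>)"
proof -
  let ?c = "\<lambda>\<alpha>. if \<alpha> = \<beta> then \<one> else \<zero>"
  have "is_expansion (\<Oplus>\<alpha>\<in>{\<beta>}. ?c \<alpha> \<otimes> mon \<alpha>) ?c"
    using assms subringE(2,3)[OF subring_R] by (intro is_expansionI) auto
  then have "is_expansion (mon \<beta>) ?c" by simp
  then show ?thesis by (simp add: coef_eqI)
qed

text \<open>
  The induction is over the terms of one fixed element \<open>f\<close>, so the case of a single term retains that
  its coefficient is one of those of \<open>f\<close>. Later uses need what is known about these coefficients.
\<close>

lemma expansion_induct [consumes 1, case_names zero mon add]:
  assumes f: "f \<in> carrier A"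
    and zero: "Q \<zero>"
    and mon: "\<And>\<alpha>. \<alpha> \<in> multi_exps n \<Longrightarrow> Q (coef f \<alpha> \<otimes> mon \<alpha>)"
    and add: "\<And>g h. g \<in> carrier A \<Longrightarrow> h \<in> carrier A \<Longrightarrow> Q g \<Longrightarrow> Q h \<Longrightarrow> Q (g \<oplus> h)"
  shows "Q f"
proof -
  have cl: "\<And>\<alpha>. coef f \<alpha> \<in> carrier A" using f coef_in_R by auto
  have "finite F \<Longrightarrow> F \<subseteq> multi_exps n \<Longrightarrow> Q (\<Oplus>\<alpha>\<in>F. coef f \<alpha> \<otimes> mon \<alpha>)" for F
  proof (induction F rule: finite_induct)
    case (insert \<alpha> F)
    then show ?case using cl mon by (subst finsum_insert) (auto intro!: add finsum_closed)
  qed (simp add: zero)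
  then show ?thesis using is_expansion_coef[OF f] unfolding is_expansion_def by metis
qed
end

section \<open>Monomials and the degree-lexicographic order\<close>

definition deg :: "nat \<Rightarrow> (nat \<Rightarrow> nat) \<Rightarrow> nat" where
  "deg n \<alpha> = (\<Sum>i<n. \<alpha> i)"

text \<open>
  The degree has to be compared first: the relation for \<open>x\<^sub>j x\<^sub>i\<close> introduces terms that are linear in
  arbitrary variables, possibly lexicographically larger ones.
\<close>

definition deglex :: "nat \<Rightarrow> (nat \<Rightarrow> nat) \<Rightarrow> (nat \<Rightarrow> nat) \<Rightarrow> bool" where
  "deglex n \<alpha> \<beta> \<longleftrightarrow> deg n \<alpha> < deg n \<beta> \<or> deg n \<alpha> = deg n \<beta> \<and> less_fun \<alpha> \<beta>"

definition exp_add :: "(nat \<Rightarrow> nat) \<Rightarrow> (nat \<Rightarrow> nat) \<Rightarrow> nat \<Rightarrow> nat" where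
  "exp_add \<alpha> \<beta> = (\<lambda>i. \<alpha> i + \<beta> i)"

definition bump :: "nat \<Rightarrow> (nat \<Rightarrow> nat) \<Rightarrow> nat \<Rightarrow> nat" where
  "bump j \<alpha> = exp_add \<alpha> (\<lambda>i. of_bool (i = j))"

lemma deg_exp_add: "deg n (exp_add \<alpha> \<beta>) = deg n \<alpha> + deg n \<beta>"
  by (simp add: deg_def exp_add_def sum.distrib)

lemma deg_bump: "j < n \<Longrightarrow> deg n (bump j \<alpha>) = Suc (deg n \<alpha>)"
  unfolding bump_def deg_exp_add by (simp add: deg_def of_bool_def)

lemma exp_add_bump: "exp_add (bump j \<alpha>) \<beta> = bump j (exp_add \<alpha> \<beta>)"
  by (simp add: bump_def exp_add_def fun_eq_iff)

lemma bump_commute: "bump i (bump j \<alpha>) = bump j (bump i \<alpha>)"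
  by (simp add: bump_def exp_add_def fun_eq_iff)

lemma bump_in_multi_exps: "j < n \<Longrightarrow> \<alpha> \<in> multi_exps n \<Longrightarrow> bump j \<alpha> \<in> multi_exps n"
  by (simp add: bump_def exp_add_def multi_exps_def)

lemma zero_in_multi_exps: "(\<lambda>_. 0) \<in> multi_exps n"
  by (simp add: multi_exps_def)

lemma deglex_irrefl: "\<not> deglex n \<alpha> \<alpha>"
  by (simp add: deglex_def less_fun_irrefl)

lemma deglex_trans: "deglex n \<alpha> \<beta> \<Longrightarrow> deglex n \<beta> \<gamma> \<Longrightarrow> deglex n \<alpha> \<gamma>"
  by (auto simp: deglex_def intro: less_fun_trans)

lemma deglex_total:
  assumes "\<alpha> \<in> multi_exps n" "\<beta> \<in> multi_exps n"
  shows "deglex n \<alpha> \<beta> \<or> \<alpha> = \<beta> \<or> deglex n \<beta> \<alpha>"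
proof -
  have "{k. \<alpha> k \<noteq> \<beta> k} \<subseteq> {..<n}"
    using assms by (force simp: multi_exps_def not_le[symmetric])
  then have "finite {k. \<alpha> k \<noteq> \<beta> k}" by (rule finite_subset) simp
  from less_fun_trichotomy[OF this] show ?thesis unfolding deglex_def by linarith
qed

lemma deglex_exp_add: "deglex n \<alpha> \<beta> \<Longrightarrow> deglex n (exp_add \<alpha> \<gamma>) (exp_add \<beta> \<gamma>)"
  by (auto simp: deglex_def deg_exp_add less_fun_def) (auto simp: exp_add_def)

lemma deglex_bump: "deglex n \<alpha> \<beta> \<Longrightarrow> deglex n (bump j \<alpha>) (bump j \<beta>)"
  unfolding bump_def by (rule deglex_exp_add)

lemma deglex_deg: "deg n \<alpha> < deg n \<beta> \<Longrightarrow> deglex n \<alpha> \<beta>"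
  by (simp add: deglex_def)

text \<open>
  Variables are added on the left, smallest index last, so that by \<open>mon_bump\<close> the new monomial is
  literally a product \<open>x j \<otimes> mon \<alpha>\<close>, without reordering.
\<close>

lemma multi_exps_induct [consumes 1, case_names zero bump]:
  assumes "\<alpha> \<in> multi_exps n"
    and zero: "Q (\<lambda>_. 0)"
    and bump: "\<And>j \<alpha>. j < n \<Longrightarrow> \<alpha> \<in> multi_exps n \<Longrightarrow> \<forall>i<j. \<alpha> i = 0 \<Longrightarrow> Q \<alpha> \<Longrightarrow> Q (bump j \<alpha>)"
  shows "Q \<alpha>"
  using assms(1)
proof (induction "deg n \<alpha>" arbitrary: \<alpha>)
  case 0
  then have "\<alpha> = (\<lambda>_. 0)"
    by (auto simp: deg_def multi_exps_def fun_eq_iff) (metis lessThan_iff not_le)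
  then show ?case using zero by simp
next
  case (Suc d)
  have "\<exists>i. \<alpha> i \<noteq> 0" using Suc(2) by (intro notI ccontr[of "\<exists>i. \<alpha> i \<noteq> 0"]) (simp add: deg_def)
  then obtain j where j: "\<alpha> j \<noteq> 0" "\<forall>i<j. \<alpha> i = 0"
    using exists_least_iff[of "\<lambda>i. \<alpha> i \<noteq> 0"] by auto
  have "\<alpha> j = 0" if "n \<le> j" using that Suc(3) by (simp add: multi_exps_def)
  with j(1) have jn: "j < n" by linarith
  define \<beta> where "\<beta> = \<alpha>(j := \<alpha> j - 1)"
  have \<beta>: "bump j \<beta> = \<alpha>" "\<beta> \<in> multi_exps n" "\<forall>i<j. \<beta> i = 0"
    using j Suc(3) by (auto simp: bump_def exp_add_def \<beta>_def fun_eq_iff multi_exps_def)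
  have "d = deg n \<beta>" using Suc(2) deg_bump[OF jn, of \<beta>] \<beta>(1) by simp
  then have "Q \<beta>" using Suc(1) \<beta>(2) by blast
  with bump[OF jn \<beta>(2,3)] \<beta>(1) show ?case by simp
qed

lemma multi_exps_cases [consumes 1, case_names zero bump]:
  assumes "\<alpha> \<in> multi_exps n"
  obtains "\<alpha> = (\<lambda>_. 0)"
  | j \<beta> where "j < n" "\<beta> \<in> multi_exps n" "\<forall>i<j. \<beta> i = 0" "\<alpha> = bump j \<beta>"
proof -
  have "\<alpha> = (\<lambda>_. 0) \<or> (\<exists>j \<beta>. j < n \<and> \<beta> \<in> multi_exps n \<and> (\<forall>i<j. \<beta> i = 0) \<and> \<alpha> = bump j \<beta>)"
    using assms by (induction rule: multi_exps_induct) blast+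
  then show thesis using that by blast
qed

context skew_PBW_extension
begin

lemma pbw_mon_bump:
  assumes "k \<le> n" "j < k" "\<forall>i<j. \<alpha> i = 0"
  shows "pbw_mon A x k (bump j \<alpha>) = x j \<otimes> pbw_mon A x k \<alpha>"
  using assms(1,2)
proof (induction k)
  case (Suc k)
  have cl: "x k \<in> carrier A" "x j \<in> carrier A" "pbw_mon A x k \<alpha> \<in> carrier A"
    using Suc.prems x_closed pbw_mon_closed by simp_all
  show ?case
  proof (cases "j = k")
    case True
    then have "pbw_mon A x k \<alpha> = \<one>" "pbw_mon A x k (bump j \<alpha>) = \<one>"
      using assms(3) by (auto intro!: pbw_mon_zero_exp ring_axioms simp: bump_def exp_add_def)
    moreover have "bump j \<alpha> k = Suc (\<alpha> k)"
      using True by (simp add: bump_def exp_add_def)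
    ultimately show ?thesis
      using True cl nat_pow_Suc2[of "x k" "\<alpha> k"] by (simp del: nat_pow_Suc)
  next
    case False
    then have "pbw_mon A x k (bump j \<alpha>) = x j \<otimes> pbw_mon A x k \<alpha>" "bump j \<alpha> k = \<alpha> k"
      using Suc by (auto simp: bump_def exp_add_def)
    with cl show ?thesis by (simp add: m_assoc)
  qed
qed simp

lemma mon_bump:
  "j < n \<Longrightarrow> \<forall>i<j. \<alpha> i = 0 \<Longrightarrow> mon (bump j \<alpha>) = x j \<otimes> mon \<alpha>"
  by (rule pbw_mon_bump) auto

lemma mon_zero: "mon (\<lambda>_. 0) = \<one>"
  by (rule pbw_mon_zero_exp[OF ring_axioms]) simp

lemma x_eq_mon: "k < n \<Longrightarrow> x k = mon (bump k (\<lambda>_. 0))"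
  using mon_bump[of k "\<lambda>_. 0"] x_closed by (simp add: mon_zero)

lemma coef_finsum_eq_zero:
  assumes "finite F" "\<And>k. k \<in> F \<Longrightarrow> h k \<in> carrier A" "\<And>k. k \<in> F \<Longrightarrow> coef (h k) \<alpha> = \<zero>"
  shows "coef (\<Oplus>k\<in>F. h k) \<alpha> = \<zero>"
  using assms
proof (induction F rule: finite_induct)
  case (insert k F)
  then show ?case by (subst finsum_insert) (auto simp: coef_add Pi_def)
qed (simp add: coef_zero)

lemma linear_part_closed:
  "s ` {..<n} \<subseteq> R \<Longrightarrow> (\<Oplus>k\<in>{..<n}. s k \<otimes> x k) \<in> carrier A"
  using x_closed by (intro finsum_closed) (auto simp: Pi_def)

lemma coef_affine:
  assumes r: "r \<in> R" and s: "s ` {..<n} \<subseteq> R" and \<epsilon>: "2 \<le> deg n \<epsilon>"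
  shows "coef (r \<oplus> (\<Oplus>k\<in>{..<n}. s k \<otimes> x k)) \<epsilon> = \<zero>"
proof -
  have "\<epsilon> \<noteq> (\<lambda>_. 0)" using \<epsilon> by (auto simp: deg_def)
  then have "coef (r \<otimes> mon (\<lambda>_. 0)) \<epsilon> = \<zero>"
    using r by (simp add: coef_smult coef_mon zero_in_multi_exps del: pbw_mon.simps)
  then have 1: "coef r \<epsilon> = \<zero>" using r by (simp add: mon_zero)
  have "coef (s k \<otimes> x k) \<epsilon> = \<zero>" if "k \<in> {..<n}" for k
  proof -
    have k: "k < n" "s k \<in> R" using that s by auto
    have "\<epsilon> \<noteq> bump k (\<lambda>_. 0)" using \<epsilon> deg_bump[OF k(1), of "\<lambda>_. 0"] by (auto simp: deg_def)
    then show ?thesis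
      using k by (simp add: coef_smult coef_mon x_eq_mon bump_in_multi_exps zero_in_multi_exps)
  qed
  then have "coef (\<Oplus>k\<in>{..<n}. s k \<otimes> x k) \<epsilon> = \<zero>"
    using s x_closed by (intro coef_finsum_eq_zero) auto
  with 1 show ?thesis using r linear_part_closed[OF s] by (simp add: coef_add)
qed

lemma coef_add_affine:
  assumes "d \<in> R" "y \<in> carrier A" "r \<in> R" "s ` {..<n} \<subseteq> R" "2 \<le> deg n \<epsilon>"
  shows "coef (d \<otimes> y \<oplus> (r \<oplus> (\<Oplus>k\<in>{..<n}. s k \<otimes> x k))) \<epsilon> = d \<otimes> coef y \<epsilon>"
proof -
  have "coef (d \<otimes> y \<oplus> (r \<oplus> (\<Oplus>k\<in>{..<n}. s k \<otimes> x k))) \<epsilon>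
      = coef (d \<otimes> y) \<epsilon> \<oplus> coef (r \<oplus> (\<Oplus>k\<in>{..<n}. s k \<otimes> x k)) \<epsilon>"
    using assms linear_part_closed by (intro coef_add) auto
  then show ?thesis
    using assms coef_in_R[of y \<epsilon>] by (simp only: coef_affine coef_smult) simp
qed

lemma x_swap:
  assumes "i < n" "j < n"
  obtains d r s where "d \<in> R" "r \<in> R" "s ` {..<n} \<subseteq> R"
    "x i \<otimes> x j = d \<otimes> (x j \<otimes> x i) \<oplus> (r \<oplus> (\<Oplus>k\<in>{..<n}. s k \<otimes> x k))"
proof -
  obtain d r s where d: "d \<in> R" "r \<in> R" "s ` {..<n} \<subseteq> R"
    and eq: "x i \<otimes> x j \<ominus> d \<otimes> (x j \<otimes> x i) = r \<oplus> (\<Oplus>k\<in>{..<n}. s k \<otimes> x k)"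
    using x_x[OF assms(2,1)] by blast
  have "x i \<otimes> x j = d \<otimes> (x j \<otimes> x i) \<oplus> (x i \<otimes> x j \<ominus> d \<otimes> (x j \<otimes> x i))"
    using d(1) x_closed assms by (simp add: minus_eq a_lcomm[of "d \<otimes> (x j \<otimes> x i)"] r_neg)
  then show thesis using that d unfolding eq by blast
qed

text \<open>
  Exchanging \<open>x\<^sub>i\<close> and \<open>x\<^sub>j\<close> and then exchanging them back leaves the coefficient of the monomial
  \<open>x\<^sub>j x\<^sub>i\<close> equal to \<open>d' d\<close>, since the remaining terms have degree at most one. As \<open>x\<^sub>j x\<^sub>i\<close> is itself a
  basis element when \<open>j < i\<close>, this coefficient is \<open>1\<close>.
\<close>

lemma x_swap_unit:
  assumes "j < i" "i < n"
  obtains d r s d' where "d \<in> R" "r \<in> R" "s ` {..<n} \<subseteq> R"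
    "x i \<otimes> x j = d \<otimes> (x j \<otimes> x i) \<oplus> (r \<oplus> (\<Oplus>k\<in>{..<n}. s k \<otimes> x k))"
    "d' \<in> R" "d' \<otimes> d = \<one>"
proof -
  have ij: "i < n" "j < n" using assms by auto
  obtain d r s where d: "d \<in> R" "r \<in> R" "s ` {..<n} \<subseteq> R"
    and eq: "x i \<otimes> x j = d \<otimes> (x j \<otimes> x i) \<oplus> (r \<oplus> (\<Oplus>k\<in>{..<n}. s k \<otimes> x k))"
    using x_swap[OF ij] .
  obtain d' r' s' where d': "d' \<in> R" "r' \<in> R" "s' ` {..<n} \<subseteq> R"
    and eq': "x j \<otimes> x i = d' \<otimes> (x i \<otimes> x j) \<oplus> (r' \<oplus> (\<Oplus>k\<in>{..<n}. s' k \<otimes> x k))"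
    using x_swap[OF ij(2,1)] .
  define \<epsilon> where "\<epsilon> = bump j (bump i (\<lambda>_. 0))"
  have \<epsilon>: "\<epsilon> \<in> multi_exps n" "2 \<le> deg n \<epsilon>"
    using ij by (simp_all add: \<epsilon>_def bump_in_multi_exps zero_in_multi_exps deg_bump)
  have "\<forall>k<j. bump i (\<lambda>_. 0) k = 0" using assms by (simp add: bump_def exp_add_def)
  then have "x j \<otimes> x i = mon \<epsilon>"
    using mon_bump[OF ij(2)] x_eq_mon[OF ij(1)] by (simp add: \<epsilon>_def)
  then have 1: "coef (x j \<otimes> x i) \<epsilon> = \<one>" using \<epsilon> by (simp add: coef_mon)
  have cl: "x i \<in> carrier A" "x j \<in> carrier A" using ij x_closed by auto
  have "coef (x i \<otimes> x j) \<epsilon> = d"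
    using coef_add_affine[OF d(1) _ d(2,3) \<epsilon>(2)] cl d(1) 1 by (simp add: eq)
  moreover have "coef (x j \<otimes> x i) \<epsilon> = d' \<otimes> coef (x i \<otimes> x j) \<epsilon>"
    using coef_add_affine[OF d'(1) _ d'(2,3) \<epsilon>(2), of "x i \<otimes> x j"] cl
    unfolding eq'[symmetric] by simp
  ultimately have "d' \<otimes> d = \<one>" using 1 by simp
  then show thesis using that d eq d'(1) by blast
qed

end

section \<open>Leading terms modulo a completely prime ideal of coefficients\<close>

text \<open>
  The part of the situation that controls leading terms: \<open>N\<close> is a completely prime ideal of \<open>R\<close>, and
  \<open>\<sigma>\<^sub>i\<close> and \<open>\<delta>\<^sub>i\<close> induce maps of \<open>R/N\<close>, the former injective. Arguing modulo \<open>N\<close> on coefficients avoids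
  the construction of a quotient of \<open>A\<close>.
\<close>

locale prime_coefficients = skew_PBW_extension A R n x
  for A :: "('a, 'b) ring_scheme" (structure) and R n x +
  fixes \<sigma> \<delta> :: "nat \<Rightarrow> 'a \<Rightarrow> 'a" and N :: "'a set"
  assumes maps: "skew_PBW_maps A R n x \<sigma> \<delta>"
    and N_ideal: "ideal N (A\<lparr>carrier := R\<rparr>)"
    and one_notin_N: "\<one> \<notin> N"
    and N_prime: "\<And>r s. r \<in> R \<Longrightarrow> s \<in> R \<Longrightarrow> r \<otimes> s \<in> N \<Longrightarrow> r \<in> N \<or> s \<in> N"
    and \<sigma>_N: "\<And>i r. i < n \<Longrightarrow> r \<in> R \<Longrightarrow> \<sigma> i r \<in> N \<longleftrightarrow> r \<in> N"
    and \<delta>_N: "\<And>i r. i < n \<Longrightarrow> r \<in> N \<Longrightarrow> \<delta> i r \<in> N"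
begin

lemma N_R: "r \<in> N \<Longrightarrow> r \<in> R"
  using ideal.Icarr[OF N_ideal] by simp

lemma N_mult:
  "r \<in> N \<Longrightarrow> s \<in> R \<Longrightarrow> r \<otimes> s \<in> N" "r \<in> N \<Longrightarrow> s \<in> R \<Longrightarrow> s \<otimes> r \<in> N"
  using ideal.I_r_closed[OF N_ideal] ideal.I_l_closed[OF N_ideal] by auto

lemma N_add: "r \<in> N \<Longrightarrow> s \<in> N \<Longrightarrow> r \<oplus> s \<in> N"
  using additive_subgroup.a_closed[OF ideal.axioms(1)[OF N_ideal]] by simp

lemma N_zero: "\<zero> \<in> N"
  using additive_subgroup.zero_closed[OF ideal.axioms(1)[OF N_ideal]] by simp

lemma N_minus:
  assumes "r \<in> N" shows "\<ominus> r \<in> N"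
proof -
  have "r \<otimes> \<ominus> \<one> \<in> N"
    using assms subringE(3,5)[OF subring_R] by (intro N_mult) auto
  then show ?thesis using assms N_R by (simp add: r_minus)
qed

lemma N_cancel:
  assumes "r \<in> R" "s \<in> N" "r \<oplus> s \<in> N" shows "r \<in> N"
proof -
  have "(r \<oplus> s) \<oplus> \<ominus> s \<in> N" by (rule N_add[OF assms(3) N_minus[OF assms(2)]])
  moreover have "(r \<oplus> s) \<oplus> \<ominus> s = r"
    using assms(1) N_R[OF assms(2)] by (simp add: a_assoc r_neg)
  ultimately show ?thesis by (simp only:)
qed

lemma \<sigma>_R: "i < n \<Longrightarrow> r \<in> R \<Longrightarrow> \<sigma> i r \<in> R"
  using maps unfolding skew_PBW_maps_def ring_hom_def by (auto simp: Pi_def)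

lemma \<delta>_R: "i < n \<Longrightarrow> r \<in> R \<Longrightarrow> \<delta> i r \<in> R"
  using maps unfolding skew_PBW_maps_def skew_derivation_def by (auto simp: Pi_def)

lemma x_scalar_mult:
  assumes "i < n" "r \<in> R" "f \<in> carrier A"
  shows "x i \<otimes> (r \<otimes> f) = \<sigma> i r \<otimes> (x i \<otimes> f) \<oplus> \<delta> i r \<otimes> f"
proof -
  have cl: "x i \<in> carrier A" "r \<in> carrier A" "\<sigma> i r \<in> carrier A" "\<delta> i r \<in> carrier A"
    using assms x_closed \<sigma>_R \<delta>_R by auto
  have "x i \<otimes> r = \<sigma> i r \<otimes> x i \<oplus> \<delta> i r"
    using maps assms unfolding skew_PBW_maps_def by blast
  then have "(x i \<otimes> r) \<otimes> f = (\<sigma> i r \<otimes> x i \<oplus> \<delta> i r) \<otimes> f" by simp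
  then show ?thesis using cl assms(3) by (simp add: m_assoc l_distr)
qed

text \<open>
  This notion and the next disregard coefficients in \<open>N\<close>: \<open>below f \<gamma>\<close> means that the image of \<open>f\<close> over \<open>R/N\<close>
  involves only monomials smaller than \<open>\<gamma>\<close>, and \<open>lead f \<gamma>\<close> that this image has leading exponent \<open>\<gamma>\<close>.
\<close>

definition below :: "'a \<Rightarrow> (nat \<Rightarrow> nat) \<Rightarrow> bool" where
  "below f \<gamma> \<longleftrightarrow> f \<in> carrier A \<and> (\<forall>\<alpha>\<in>multi_exps n. deglex n \<alpha> \<gamma> \<or> coef f \<alpha> \<in> N)"

definition lead :: "'a \<Rightarrow> (nat \<Rightarrow> nat) \<Rightarrow> bool" where
  "lead f \<gamma> \<longleftrightarrow> f \<in> carrier A \<and> \<gamma> \<in> multi_exps n \<and> coef f \<gamma> \<notin> N \<and>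
     (\<forall>\<alpha>\<in>multi_exps n. deglex n \<alpha> \<gamma> \<or> \<alpha> = \<gamma> \<or> coef f \<alpha> \<in> N)"

lemma below_closed: "below f \<gamma> \<Longrightarrow> f \<in> carrier A"
  by (simp add: below_def)

lemma lead_closed: "lead f \<gamma> \<Longrightarrow> f \<in> carrier A"
  by (simp add: lead_def)

lemma below_zero: "below \<zero> \<gamma>"
  by (simp add: below_def coef_zero N_zero)

lemma below_add: "below f \<gamma> \<Longrightarrow> below g \<gamma> \<Longrightarrow> below (f \<oplus> g) \<gamma>"
  unfolding below_def by (metis N_add a_closed coef_add)

lemma below_smult: "r \<in> R \<Longrightarrow> below f \<gamma> \<Longrightarrow> below (r \<otimes> f) \<gamma>"
  unfolding below_def by (metis N_mult(2) R_closed m_closed coef_smult)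

lemma below_N_smult: "r \<in> N \<Longrightarrow> f \<in> carrier A \<Longrightarrow> below (r \<otimes> f) \<gamma>"
  unfolding below_def by (metis N_mult(1) N_R R_closed m_closed coef_smult coef_in_R)

lemma lead_below: "lead f \<beta> \<Longrightarrow> deglex n \<beta> \<gamma> \<Longrightarrow> below f \<gamma>"
  unfolding lead_def below_def by (metis deglex_trans)

lemma lead_add_below:
  assumes "lead f \<gamma>" "below g \<gamma>" shows "lead (f \<oplus> g) \<gamma>"
proof -
  have cl: "f \<in> carrier A" "g \<in> carrier A" "\<gamma> \<in> multi_exps n"
    using assms by (simp_all add: lead_def below_def)
  have "coef g \<gamma> \<in> N"
    using assms(2) cl(3) deglex_irrefl unfolding below_def by blast
  then have "coef (f \<oplus> g) \<gamma> \<notin> N"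
    using assms(1) N_cancel[of "coef f \<gamma>" "coef g \<gamma>"] cl coef_in_R
    by (auto simp: coef_add lead_def)
  moreover have "deglex n \<alpha> \<gamma> \<or> \<alpha> = \<gamma> \<or> coef (f \<oplus> g) \<alpha> \<in> N" if "\<alpha> \<in> multi_exps n" for \<alpha>
    using assms that cl unfolding lead_def below_def by (metis N_add coef_add)
  ultimately show ?thesis using cl by (simp add: lead_def)
qed

lemma lead_smult:
  assumes "lead f \<gamma>" "r \<in> R" "r \<notin> N" shows "lead (r \<otimes> f) \<gamma>"
  using assms N_prime[of r "coef f \<gamma>"] coef_in_R[of f] N_mult(2)
  unfolding lead_def by (auto simp: coef_smult)

lemma lead_mon: "\<alpha> \<in> multi_exps n \<Longrightarrow> lead (mon \<alpha>) \<alpha>"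
  using one_notin_N N_zero by (simp add: lead_def coef_mon)

lemma below_mon: "\<alpha> \<in> multi_exps n \<Longrightarrow> deglex n \<alpha> \<gamma> \<Longrightarrow> below (mon \<alpha>) \<gamma>"
  by (rule lead_below[OF lead_mon])

lemma lead_decompose:
  assumes "lead f \<gamma>"
  obtains a g where "a \<in> R" "a \<notin> N" "below g \<gamma>" "f = a \<otimes> mon \<gamma> \<oplus> g"
proof
  have \<gamma>: "\<gamma> \<in> multi_exps n" and f: "f \<in> carrier A" using assms by (simp_all add: lead_def)
  define a where "a = coef f \<gamma>"
  define g where "g = (\<ominus> a) \<otimes> mon \<gamma> \<oplus> f"
  have a: "a \<in> R" "\<ominus> a \<in> R" using f coef_in_R subringE(5)[OF subring_R] by (simp_all add: a_def)
  show "coef f \<gamma> \<in> R" "coef f \<gamma> \<notin> N" using assms a by (simp_all add: lead_def a_def)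
  have "coef g \<alpha> = (if \<alpha> = \<gamma> then \<zero> else coef f \<alpha>)" for \<alpha>
    using f a \<gamma> coef_in_R[OF f] by (simp add: g_def coef_add coef_smult coef_mon a_def[symmetric] l_neg)
  then show "below g \<gamma>"
    using assms f a N_zero by (auto simp: below_def lead_def g_def)
  show "f = coef f \<gamma> \<otimes> mon \<gamma> \<oplus> g"
    using f a by (simp add: g_def a_def[symmetric] l_minus a_assoc[symmetric] r_neg)
qed

lemma lead_exists:
  assumes f: "f \<in> carrier A" and "\<exists>\<alpha>\<in>multi_exps n. coef f \<alpha> \<notin> N"
  shows "\<exists>\<gamma>. lead f \<gamma>"
proof -
  let ?S = "{\<alpha> \<in> multi_exps n. coef f \<alpha> \<notin> N}"
  have "?S \<subseteq> {\<alpha>. coef f \<alpha> \<noteq> \<zero>}" using N_zero by auto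
  then have fin: "finite ?S" using finite_coef[OF f] finite_subset by blast
  have "asymp_on ?S (deglex n)" "transp_on ?S (deglex n)"
    by (auto intro!: asymp_onI transp_onI dest: deglex_trans simp: deglex_irrefl)
  from Finite_Set.bex_max_element[OF fin this] obtain \<gamma>
    where \<gamma>: "\<gamma> \<in> ?S" "\<forall>\<alpha>\<in>?S. \<alpha> \<noteq> \<gamma> \<longrightarrow> \<not> deglex n \<gamma> \<alpha>"
    using assms(2) by blast
  then have "lead f \<gamma>" using f deglex_total unfolding lead_def by blast
  then show ?thesis by blast
qed

lemma below_finsum:
  assumes "finite F" "\<And>k. k \<in> F \<Longrightarrow> below (h k) \<gamma>"
  shows "below (\<Oplus>k\<in>F. h k) \<gamma>"
  using assms
proof (induction F rule: finite_induct)
  case (insert k F)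
  then show ?case
    using below_closed by (subst finsum_insert) (auto intro: below_add simp: Pi_def)
qed (simp add: below_zero)

text \<open>
  Stated relative to knowledge about \<open>x i \<otimes> mon \<beta>\<close> for \<open>\<beta>\<close> smaller than \<open>\<gamma>\<close>, since it serves inside the
  induction that establishes this knowledge.
\<close>

lemma below_x_mult:
  assumes i: "i < n" and f: "below f \<gamma>"
    and xmon: "\<And>\<beta>. \<beta> \<in> multi_exps n \<Longrightarrow> deglex n \<beta> \<gamma> \<Longrightarrow> lead (x i \<otimes> mon \<beta>) (bump i \<beta>)"
    and \<gamma>: "deglex n \<gamma> (bump i \<gamma>)"
  shows "below (x i \<otimes> f) (bump i \<gamma>)"
  using below_closed[OF f]
proof (induction rule: expansion_induct)
  case zero
  then show ?case using x_closed[OF i] by (simp add: below_zero)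
next
  case (mon \<beta>)
  let ?r = "coef f \<beta>"
  have r: "?r \<in> R" using below_closed[OF f] coef_in_R by blast
  have xm: "x i \<otimes> mon \<beta> \<in> carrier A" using x_closed[OF i] by simp
  have "below (\<sigma> i ?r \<otimes> (x i \<otimes> mon \<beta>) \<oplus> \<delta> i ?r \<otimes> mon \<beta>) (bump i \<gamma>)"
  proof (cases "?r \<in> N")
    case True
    then have "\<sigma> i ?r \<in> N" "\<delta> i ?r \<in> N" using i r \<sigma>_N \<delta>_N by blast+
    then show ?thesis using xm by (intro below_add below_N_smult) auto
  next
    case False
    then have less: "deglex n \<beta> \<gamma>" using f mon unfolding below_def by blast
    then have "below (x i \<otimes> mon \<beta>) (bump i \<gamma>)"
      using lead_below[OF xmon[OF mon less]] deglex_bump by blast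
    moreover have "below (mon \<beta>) (bump i \<gamma>)"
      using below_mon[OF mon] less \<gamma> deglex_trans by blast
    ultimately show ?thesis
      by (intro below_add below_smult[OF \<sigma>_R[OF i r]] below_smult[OF \<delta>_R[OF i r]])
  qed
  then show ?case using x_scalar_mult[OF i r] by simp
next
  case (add g h)
  then show ?case using x_closed[OF i] by (simp add: r_distr below_add)
qed

lemma deglex_bump_self: "i < n \<Longrightarrow> deglex n \<gamma> (bump i \<gamma>)"
  by (simp add: deglex_deg deg_bump)

text \<open>
  As before, in a form usable while the behaviour of \<open>x i\<close> on monomials is known only up to \<open>\<gamma>\<close>.
\<close>

lemma lead_x_mult_from_mon:
  assumes i: "i < n" and f: "lead f \<gamma>"
    and mon: "\<And>\<beta>. \<beta> \<in> multi_exps n \<Longrightarrow> \<beta> = \<gamma> \<or> deglex n \<beta> \<gamma> \<Longrightarrow> lead (x i \<otimes> mon \<beta>) (bump i \<beta>)"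
  shows "lead (x i \<otimes> f) (bump i \<gamma>)"
proof -
  obtain a g where a: "a \<in> R" "a \<notin> N" and g: "below g \<gamma>" and fe: "f = a \<otimes> mon \<gamma> \<oplus> g"
    using lead_decompose[OF f] .
  have \<gamma>: "\<gamma> \<in> multi_exps n" using f by (simp add: lead_def)
  have cl: "a \<in> carrier A" "x i \<in> carrier A" "g \<in> carrier A" "\<sigma> i a \<in> carrier A" "\<delta> i a \<in> carrier A"
    using a g i x_closed below_closed \<sigma>_R \<delta>_R by auto
  have "lead (\<sigma> i a \<otimes> (x i \<otimes> mon \<gamma>)) (bump i \<gamma>)"
    using a i \<sigma>_R \<sigma>_N lead_smult[OF mon[OF \<gamma>]] by simp
  moreover have "below (\<delta> i a \<otimes> mon \<gamma>) (bump i \<gamma>)"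
    by (rule below_smult[OF \<delta>_R[OF i a(1)] below_mon[OF \<gamma> deglex_bump_self[OF i]]])
  moreover have "below (x i \<otimes> g) (bump i \<gamma>)"
    using mon by (intro below_x_mult i g deglex_bump_self) blast
  moreover have "x i \<otimes> f = (\<sigma> i a \<otimes> (x i \<otimes> mon \<gamma>) \<oplus> \<delta> i a \<otimes> mon \<gamma>) \<oplus> x i \<otimes> g"
    using cl x_scalar_mult[OF i a(1), of "mon \<gamma>"] by (simp add: fe r_distr)
  ultimately show ?thesis by (simp add: lead_add_below)
qed

text \<open>
  The induction is on the degree of \<open>\<alpha>\<close> and, within one degree, on the index \<open>i\<close>. Let \<open>j\<close> be the
  smallest variable in \<open>x\<^sup>\<alpha> = x\<^sub>j x\<^sup>\<beta>\<close>. If \<open>i \<le> j\<close>, then \<open>x\<^sub>i x\<^sup>\<alpha>\<close> is a monomial. Otherwise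
  \<open>x\<^sub>i x\<^sub>j x\<^sup>\<beta> = d x\<^sub>j (x\<^sub>i x\<^sup>\<beta>) + \<dots>\<close>: the element \<open>x\<^sub>i x\<^sup>\<beta>\<close> is covered by the induction on the degree, but
  its expansion may contain monomials of the same degree as \<open>x\<^sup>\<alpha>\<close> whose smallest variable precedes
  \<open>x\<^sub>j\<close>; multiplying those by \<open>x\<^sub>j\<close> is covered by the inner induction because \<open>j < i\<close>.
\<close>

lemma lead_x_mon:
  assumes "i < n" "\<alpha> \<in> multi_exps n"
  shows "lead (x i \<otimes> mon \<alpha>) (bump i \<alpha>)"
  using assms
proof (induction "deg n \<alpha>" arbitrary: i \<alpha> rule: less_induct)
  case (less \<alpha>)
  note IH_deg = less.hyps
  show ?case using less.prems IH_deg
  proof (induction i arbitrary: \<alpha> rule: less_induct)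
    case (less i)
    note IH_i = less.IH and IH_deg = less.prems(3)
    note i = \<open>i < n\<close>
    from \<open>\<alpha> \<in> multi_exps n\<close> show ?case
    proof (cases rule: multi_exps_cases)
      case zero
      have "x i \<otimes> mon \<alpha> = mon (bump i \<alpha>)"
        using i zero by (simp add: mon_bump)
      then show ?thesis using i less.prems(2) by (simp add: lead_mon bump_in_multi_exps)
    next
      case (bump j \<beta>)
      note \<beta> = \<open>\<beta> \<in> multi_exps n\<close>
      have m: "mon \<alpha> = x j \<otimes> mon \<beta>" using bump by (simp add: mon_bump)
      have deg: "deg n \<alpha> = Suc (deg n \<beta>)" using bump by (simp add: deg_bump)
      show ?thesis
      proof (cases "i \<le> j")
        case True
        then have "\<forall>k<i. \<alpha> k = 0" using bump by (simp add: bump_def exp_add_def)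
        then have "x i \<otimes> mon \<alpha> = mon (bump i \<alpha>)" using i by (simp add: mon_bump)
        then show ?thesis using i less.prems(2) by (simp add: lead_mon bump_in_multi_exps)
      next
        case False
        then have ji: "j < i" by simp
        have IH\<beta>: "lead (x k \<otimes> mon \<beta>) (bump k \<beta>)" if "k < n" for k
          using IH_deg[OF _ that \<beta>] deg by simp
        obtain d r s d' where d: "d \<in> R" "r \<in> R" "s ` {..<n} \<subseteq> R"
          and swap: "x i \<otimes> x j = d \<otimes> (x j \<otimes> x i) \<oplus> (r \<oplus> (\<Oplus>k\<in>{..<n}. s k \<otimes> x k))"
          and d': "d' \<in> R" "d' \<otimes> d = \<one>"
          using x_swap_unit[OF ji i] .
        have dN: "d \<notin> N" using d'(1) N_mult(2) one_notin_N unfolding d'(2)[symmetric] by blast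
        \<comment> \<open>The exponents met on applying \<open>x j\<close> below have at most this degree: the bound needed for \<open>IH_i\<close>.\<close>
        have degi: "deg n (bump i \<beta>) = deg n \<alpha>" using deg i by (simp add: deg_bump)
        have "lead (x j \<otimes> (x i \<otimes> mon \<beta>)) (bump j (bump i \<beta>))"
        proof (rule lead_x_mult_from_mon[OF \<open>j < n\<close> IH\<beta>[OF i]])
          fix \<eta> assume \<eta>: "\<eta> \<in> multi_exps n" "\<eta> = bump i \<beta> \<or> deglex n \<eta> (bump i \<beta>)"
          then have "deg n \<eta> \<le> deg n \<alpha>" using degi by (auto simp: deglex_def)
          then show "lead (x j \<otimes> mon \<eta>) (bump j \<eta>)"
            using IH_i[OF ji \<open>j < n\<close> \<eta>(1)] IH_deg by simp
        qed
        then have top: "lead (d \<otimes> (x j \<otimes> (x i \<otimes> mon \<beta>))) (bump i \<alpha>)"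
          using d dN bump by (simp add: lead_smult bump_commute)
        have less\<beta>: "deglex n (bump k \<beta>) (bump i \<alpha>)" if "k < n" for k
          using that i deg by (intro deglex_deg) (simp add: deg_bump)
        have "deglex n \<beta> (bump i \<alpha>)"
          using i deg by (intro deglex_deg) (simp add: deg_bump)
        then have low1: "below (r \<otimes> mon \<beta>) (bump i \<alpha>)"
          using d \<beta> by (intro below_smult below_mon) auto
        \<comment> \<open>Here \<open>x k \<otimes> mon \<beta>\<close> has the degree of \<open>\<alpha>\<close>, one less than that of \<open>bump i \<alpha>\<close>.\<close>
        have low2: "below (\<Oplus>k\<in>{..<n}. s k \<otimes> (x k \<otimes> mon \<beta>)) (bump i \<alpha>)"
        proof (rule below_finsum)
          fix k assume "k \<in> {..<n}"
          then have k: "k < n" "s k \<in> R" using d(3) by auto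
          show "below (s k \<otimes> (x k \<otimes> mon \<beta>)) (bump i \<alpha>)"
            by (rule below_smult[OF k(2) lead_below[OF IH\<beta>[OF k(1)] less\<beta>[OF k(1)]]])
        qed simp
        have cl: "x i \<in> carrier A" "x j \<in> carrier A" "d \<in> carrier A" "r \<in> carrier A"
          using i bump(1) d x_closed by auto
        have sx: "(\<lambda>k. s k \<otimes> x k) \<in> {..<n} \<rightarrow> carrier A" using d(3) x_closed by auto
        have "(\<Oplus>k\<in>{..<n}. s k \<otimes> x k) \<otimes> mon \<beta> = (\<Oplus>k\<in>{..<n}. s k \<otimes> x k \<otimes> mon \<beta>)"
          using sx by (intro finsum_ldistr) auto
        also have "\<dots> = (\<Oplus>k\<in>{..<n}. s k \<otimes> (x k \<otimes> mon \<beta>))"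
          using d(3) x_closed by (intro finsum_cong') (auto simp: m_assoc)
        finally have lin: "(\<Oplus>k\<in>{..<n}. s k \<otimes> x k) \<otimes> mon \<beta> = (\<Oplus>k\<in>{..<n}. s k \<otimes> (x k \<otimes> mon \<beta>))" .
        have "x i \<otimes> mon \<alpha> = (x i \<otimes> x j) \<otimes> mon \<beta>"
          using cl by (simp add: m m_assoc)
        also have "\<dots> = d \<otimes> (x j \<otimes> (x i \<otimes> mon \<beta>)) \<oplus>
            (r \<otimes> mon \<beta> \<oplus> (\<Oplus>k\<in>{..<n}. s k \<otimes> (x k \<otimes> mon \<beta>)))"
          using cl linear_part_closed[OF d(3)] by (simp add: swap l_distr lin m_assoc)
        finally show ?thesis using top low1 low2 by (simp add: lead_add_below below_add)
      qed
    qed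
  qed
qed

lemma lead_x_mult: "i < n \<Longrightarrow> lead f \<gamma> \<Longrightarrow> lead (x i \<otimes> f) (bump i \<gamma>)"
  by (rule lead_x_mult_from_mon) (auto intro: lead_x_mon)

lemma lead_mon_mult:
  assumes "\<alpha> \<in> multi_exps n" "lead f \<gamma>"
  shows "lead (mon \<alpha> \<otimes> f) (exp_add \<alpha> \<gamma>)"
  using assms(1)
proof (induction rule: multi_exps_induct)
  case zero
  then show ?case using assms(2) lead_closed by (simp add: mon_zero exp_add_def)
next
  case (bump j \<alpha>)
  then have "lead (x j \<otimes> (mon \<alpha> \<otimes> f)) (bump j (exp_add \<alpha> \<gamma>))" by (simp add: lead_x_mult)
  then show ?case
    using bump lead_closed[OF assms(2)] x_closed by (simp add: mon_bump exp_add_bump m_assoc)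
qed

lemma below_mult:
  assumes f: "below f \<alpha>" and g: "lead g \<gamma>"
  shows "below (f \<otimes> g) (exp_add \<alpha> \<gamma>)"
  using below_closed[OF f]
proof (induction rule: expansion_induct)
  case zero
  then show ?case using lead_closed[OF g] by (simp add: below_zero)
next
  case (mon \<beta>)
  let ?r = "coef f \<beta>"
  have r: "?r \<in> R" using below_closed[OF f] coef_in_R by blast
  have "below (?r \<otimes> (mon \<beta> \<otimes> g)) (exp_add \<alpha> \<gamma>)"
  proof (cases "?r \<in> N")
    case True
    then show ?thesis using lead_closed[OF g] by (simp add: below_N_smult)
  next
    case False
    then have "deglex n \<beta> \<alpha>" using f mon unfolding below_def by blast
    then have "below (mon \<beta> \<otimes> g) (exp_add \<alpha> \<gamma>)"
      using lead_below[OF lead_mon_mult[OF mon g]] deglex_exp_add by blast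
    then show ?thesis using r by (rule below_smult[rotated])
  qed
  then show ?case using r lead_closed[OF g] by (simp add: m_assoc)
next
  case (add h k)
  then show ?case using lead_closed[OF g] by (simp add: l_distr below_add)
qed

lemma lead_mult:
  assumes f: "lead f \<alpha>" and g: "lead g \<gamma>"
  shows "lead (f \<otimes> g) (exp_add \<alpha> \<gamma>)"
proof -
  obtain a h where a: "a \<in> R" "a \<notin> N" and h: "below h \<alpha>" and fe: "f = a \<otimes> mon \<alpha> \<oplus> h"
    using lead_decompose[OF f] .
  have \<alpha>: "\<alpha> \<in> multi_exps n" using f by (simp add: lead_def)
  have "lead (a \<otimes> (mon \<alpha> \<otimes> g) \<oplus> h \<otimes> g) (exp_add \<alpha> \<gamma>)"
    using a by (intro lead_add_below lead_smult lead_mon_mult below_mult \<alpha> g h)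
  moreover have "f \<otimes> g = a \<otimes> (mon \<alpha> \<otimes> g) \<oplus> h \<otimes> g"
    using a below_closed[OF h] lead_closed[OF g] by (simp add: fe l_distr m_assoc)
  ultimately show ?thesis by simp
qed

definition coefs_in_N :: "'a \<Rightarrow> bool" where
  "coefs_in_N f \<longleftrightarrow> (\<forall>\<alpha>. coef f \<alpha> \<in> N)"

text \<open>
  An element with some coefficient outside \<open>N\<close> has a leading exponent (\<open>lead_exists\<close>), and leading
  exponents add under multiplication (\<open>lead_mult\<close>).
\<close>

lemma coefs_in_N_prime:
  assumes "f \<in> carrier A" "g \<in> carrier A" "coefs_in_N (f \<otimes> g)"
  shows "coefs_in_N f \<or> coefs_in_N g"
proof (rule ccontr)
  assume "\<not> ?thesis"
  then obtain \<alpha> \<gamma> where "lead f \<alpha>" "lead g \<gamma>"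
    using lead_exists assms coef_outside N_zero unfolding coefs_in_N_def by metis
  then show False using lead_mult assms(3) unfolding lead_def coefs_in_N_def by blast
qed

lemma one_not_coefs_in_N: "\<not> coefs_in_N \<one>"
  using lead_mon[OF zero_in_multi_exps] unfolding lead_def coefs_in_N_def mon_zero by blast

lemma coefs_in_N_principal:
  assumes N: "N = {c \<otimes> s | s. s \<in> R}" and cN: "c \<in> N" and f_closed: "f \<in> carrier A"
  shows "coefs_in_N f \<longleftrightarrow> (\<exists>h\<in>carrier A. f = c \<otimes> h)"
proof
  from cN have c: "c \<in> carrier A" using N_R by simp
  show "coefs_in_N f" if "\<exists>h\<in>carrier A. f = c \<otimes> h"
    using that cN N_R N_mult(1) coef_in_R by (auto simp: coefs_in_N_def coef_smult)
  assume f: "coefs_in_N f"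
  from f_closed show "\<exists>h\<in>carrier A. f = c \<otimes> h"
  proof (induction rule: expansion_induct)
    case zero
    show ?case using c by (intro bexI[of _ \<zero>]) auto
  next
    case (mon \<alpha>)
    have "coef f \<alpha> \<in> N" using f by (simp add: coefs_in_N_def)
    then obtain s where s: "s \<in> R" "coef f \<alpha> = c \<otimes> s" using N by blast
    then show ?case using c by (intro bexI[of _ "s \<otimes> mon \<alpha>"]) (auto simp: m_assoc)
  next
    case (add g h)
    then obtain g' h' where "g' \<in> carrier A" "g = c \<otimes> g'" "h' \<in> carrier A" "h = c \<otimes> h'" by blast
    then show ?case using c by (intro bexI[of _ "g' \<oplus> h'"]) (auto simp: r_distr)
  qed
qed

text \<open>
  The elements \<open>a\<close> with \<open>ac \<in> cA\<close> are closed under addition and multiplication; they contain \<open>R\<close>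
  because \<open>Rc \<subseteq> N = cR\<close>, and each \<open>x\<^sub>i\<close> because \<open>\<sigma>\<^sub>i c\<close> and \<open>\<delta>\<^sub>i c\<close> lie in \<open>N = cR\<close>.
\<close>

lemma left_mult_principal:
  assumes N: "N = {c \<otimes> s | s. s \<in> R}" and cN: "c \<in> N" and a: "a \<in> carrier A"
  shows "\<exists>b\<in>carrier A. a \<otimes> c = c \<otimes> b"
proof -
  have c: "c \<in> R" using cN N_R by simp
  have monc: "\<exists>b\<in>carrier A. mon \<alpha> \<otimes> c = c \<otimes> b" if "\<alpha> \<in> multi_exps n" for \<alpha>
    using that
  proof (induction rule: multi_exps_induct)
    case zero
    then show ?case using c by (intro bexI[of _ \<one>]) (auto simp: mon_zero)
  next
    case (bump j \<alpha>)
    then obtain b where b: "b \<in> carrier A" "mon \<alpha> \<otimes> c = c \<otimes> b" by blast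
    have "\<sigma> j c \<in> N" "\<delta> j c \<in> N" using bump(1) c cN \<sigma>_N \<delta>_N by blast+
    then obtain s t where st: "s \<in> R" "\<sigma> j c = c \<otimes> s" "t \<in> R" "\<delta> j c = c \<otimes> t"
      using N by blast
    have xj: "x j \<in> carrier A" using bump(1) x_closed by simp
    have "mon (bump j \<alpha>) \<otimes> c = x j \<otimes> (c \<otimes> b)"
      using bump c xj b by (simp add: mon_bump m_assoc)
    also have "\<dots> = c \<otimes> (s \<otimes> (x j \<otimes> b) \<oplus> t \<otimes> b)"
      using x_scalar_mult[OF bump(1) c b(1)] st c b xj by (simp add: r_distr m_assoc)
    finally show ?case
      using st b xj by (intro bexI[of _ "s \<otimes> (x j \<otimes> b) \<oplus> t \<otimes> b"]) auto
  qed
  from a show ?thesis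
  proof (induction rule: expansion_induct)
    case zero
    show ?case using c by (intro bexI[of _ \<zero>]) auto
  next
    case (mon \<alpha>)
    obtain b where b: "b \<in> carrier A" "mon \<alpha> \<otimes> c = c \<otimes> b" using monc[OF mon] by blast
    have r: "coef a \<alpha> \<in> R" using a coef_in_R by blast
    then have "coef a \<alpha> \<otimes> c \<in> N" using cN N_mult(2) by blast
    then obtain s where s: "s \<in> R" "coef a \<alpha> \<otimes> c = c \<otimes> s" using N by blast
    have "coef a \<alpha> \<otimes> mon \<alpha> \<otimes> c = (coef a \<alpha> \<otimes> c) \<otimes> b"
      using r c b by (simp add: m_assoc)
    also have "\<dots> = c \<otimes> (s \<otimes> b)" using s c b by (simp add: m_assoc)
    finally show ?case using s b by (intro bexI[of _ "s \<otimes> b"]) auto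
  next
    case (add g h)
    then obtain g' h' where "g' \<in> carrier A" "g \<otimes> c = c \<otimes> g'" "h' \<in> carrier A" "h \<otimes> c = c \<otimes> h'"
      by blast
    then show ?case using c add by (intro bexI[of _ "g' \<oplus> h'"]) (auto simp: l_distr r_distr)
  qed
qed

section \<open>Nilpotent elements and weak annihilators of the extension\<close>

lemma nilpotents_principal:
  assumes N: "N = {c \<otimes> s | s. s \<in> R}" and cN: "c \<in> N" and c: "c \<in> nilpotents A"
  shows "f \<in> nilpotents A \<longleftrightarrow> f \<in> carrier A \<and> coefs_in_N f"
proof
  assume f: "f \<in> nilpotents A"
  then obtain k :: nat where cl: "f \<in> carrier A" and "f [^] k = \<zero>"
    unfolding nilpotents_def by blast
  then have "coefs_in_N (f [^] k)" using N_zero by (simp add: coefs_in_N_def coef_zero)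
  then have "coefs_in_N f"
  proof (induction k)
    case (Suc k)
    then show ?case using coefs_in_N_prime[of "f [^] k" f] cl by auto
  qed (simp add: one_not_coefs_in_N)
  with cl show "f \<in> carrier A \<and> coefs_in_N f" ..
next
  assume f: "f \<in> carrier A \<and> coefs_in_N f"
  then obtain h where h: "h \<in> carrier A" "f = c \<otimes> h"
    using coefs_in_N_principal[OF N cN] by blast
  have "c \<otimes> h \<in> nilpotents A"
    by (rule nilpotent_right_multiple[OF c h(1) left_mult_principal[OF N cN]])
  then show "f \<in> nilpotents A" using h(2) by simp
qed

lemma weak_annihilator_nilpotently_generated:
  assumes N: "N = {c \<otimes> s | s. s \<in> R}" and cN: "c \<in> N" and c: "c \<in> nilpotents A"
    and f: "f \<in> carrier A" "f \<notin> nilpotents A"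
  shows "nilpotently_generated A (weak_annihilator A {f})"
proof -
  note nil = nilpotents_principal[OF N cN c]
  note principal = coefs_in_N_principal[OF N cN]
  have cl: "c \<in> carrier A" using cN N_R by simp
  have "a \<in> weak_annihilator A {f} \<longleftrightarrow> (\<exists>h\<in>carrier A. a = c \<otimes> h)" for a
  proof
    assume "a \<in> weak_annihilator A {f}"
    then have a: "a \<in> carrier A" "f \<otimes> a \<in> nilpotents A"
      by (simp_all add: weak_annihilator_single)
    then have "coefs_in_N a" using coefs_in_N_prime[OF f(1) a(1)] f nil by blast
    then show "\<exists>h\<in>carrier A. a = c \<otimes> h" using principal[OF a(1)] by blast
  next
    assume "\<exists>h\<in>carrier A. a = c \<otimes> h"
    then obtain h where h: "h \<in> carrier A" "a = c \<otimes> h" by blast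
    obtain b where b: "b \<in> carrier A" "f \<otimes> c = c \<otimes> b"
      using left_mult_principal[OF N cN f(1)] by blast
    have "f \<otimes> a = (f \<otimes> c) \<otimes> h" using h cl f(1) by (simp add: m_assoc)
    also have "\<dots> = c \<otimes> (b \<otimes> h)" using b cl h(1) by (simp add: m_assoc)
    finally have "coefs_in_N (f \<otimes> a)"
      using principal[of "f \<otimes> a"] b(1) h cl f(1) by auto
    then show "a \<in> weak_annihilator A {f}"
      using nil h cl f(1) by (simp add: weak_annihilator_single)
  qed
  then have "weak_annihilator A {f} = {c \<otimes> s | s. s \<in> carrier A}" by blast
  with c show ?thesis unfolding nilpotently_generated_def by (rule bexI[rotated])
qed
end

theorem theorem3p15:
  fixes A :: "('a, 'b) ring_scheme" and R :: "'a set" and n :: nat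
    and x :: "nat \<Rightarrow> 'a" and \<sigma> \<delta> :: "nat \<Rightarrow> 'a \<Rightarrow> 'a"
  assumes "skew_PBW_extension A R n x"
    and "skew_PBW_maps A R n x \<sigma> \<delta>"
    and "Sigma_Delta_compatible (A\<lparr>carrier := R\<rparr>) n \<sigma> \<delta>"
    and "NI_ring (A\<lparr>carrier := R\<rparr>)"
    and "\<forall>p\<in>R. p \<notin> nilpotents (A\<lparr>carrier := R\<rparr>) \<longrightarrow>
           nilpotently_generated (A\<lparr>carrier := R\<rparr>) (weak_annihilator (A\<lparr>carrier := R\<rparr>) {p})"
  shows "\<forall>f\<in>carrier A. f \<notin> nilpotents A \<longrightarrow>
           nilpotently_generated A (weak_annihilator A {f})"
proof (intro ballI impI)
  fix f assume f: "f \<in> carrier A" "f \<notin> nilpotents A"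
  let ?S = "A\<lparr>carrier := R\<rparr>"
  interpret skew_PBW_extension A R n x by fact
  interpret S: ring ?S using assms(4) by (simp add: NI_ring_def)
  have Sigma: "Sigma_compatible ?S n \<sigma>" and Delta: "Delta_compatible ?S n \<delta>"
    using assms(3) by (simp_all add: Sigma_Delta_compatible_def)
  have pow: "a [^]\<^bsub>?S\<^esub> k = a [^]\<^bsub>A\<^esub> k" for a and k :: nat
    by (rule nat_pow_consistent[symmetric])
  have nil_sub: "nilpotents ?S \<subseteq> nilpotents A"
    unfolding nilpotents_def pow by auto
  \<comment> \<open>If \<open>1\<close> were nilpotent, \<open>A\<close> would be the zero ring, which has no non-nilpotent \<open>f\<close>.\<close>
  have one: "\<one>\<^bsub>?S\<^esub> \<notin> nilpotents ?S"
  proof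
    assume "\<one>\<^bsub>?S\<^esub> \<in> nilpotents ?S"
    then have "\<one>\<^bsub>A\<^esub> = \<zero>\<^bsub>A\<^esub>" unfolding nilpotents_def pow by auto
    then have "f = \<zero>\<^bsub>A\<^esub>" using f(1) by (metis l_one l_null)
    then have "f [^]\<^bsub>A\<^esub> (1::nat) = \<zero>\<^bsub>A\<^esub>" by simp
    with f show False using nilpotentsI by blast
  qed
  obtain c where c: "c \<in> nilpotents ?S"
    and N: "nilpotents ?S = {c \<otimes>\<^bsub>?S\<^esub> s | s. s \<in> carrier ?S}"
    and prime: "\<And>p q. p \<in> carrier ?S \<Longrightarrow> q \<in> carrier ?S \<Longrightarrow> p \<otimes>\<^bsub>?S\<^esub> q \<in> nilpotents ?S \<Longrightarrow>
      p \<in> nilpotents ?S \<or> q \<in> nilpotents ?S"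
    using S.nilpotents_prime_principal[OF assms(4) one] assms(5) by auto
  interpret P: prime_coefficients A R n x \<sigma> \<delta> "nilpotents ?S"
  proof (intro prime_coefficients.intro prime_coefficients_axioms.intro)
    show "skew_PBW_extension A R n x" by fact
    show "skew_PBW_maps A R n x \<sigma> \<delta>" by fact
    show "ideal (nilpotents ?S) ?S" by (rule S.NI_nilpotents_ideal[OF assms(4)])
    show "\<one>\<^bsub>A\<^esub> \<notin> nilpotents ?S" using one by simp
    show "r \<in> nilpotents ?S \<or> s \<in> nilpotents ?S"
      if "r \<in> R" "s \<in> R" "r \<otimes>\<^bsub>A\<^esub> s \<in> nilpotents ?S" for r s
      using prime[of r s] that by simp
    fix i assume i: "i < n"
    show "\<sigma> i r \<in> nilpotents ?S \<longleftrightarrow> r \<in> nilpotents ?S" if "r \<in> R" for r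
      using assms(2) i that unfolding skew_PBW_maps_def by (intro S.nilpotents_inj_hom) auto
    interpret D: compatible_skew_derivation ?S "\<sigma> i" "\<delta> i"
    proof
      show "\<sigma> i \<in> ring_hom ?S ?S" "skew_derivation ?S (\<sigma> i) (\<delta> i)"
        using assms(2) i unfolding skew_PBW_maps_def by blast+
      fix a b assume ab: "a \<in> carrier ?S" "b \<in> carrier ?S"
      show "a \<otimes>\<^bsub>?S\<^esub> \<sigma> i b = \<zero>\<^bsub>?S\<^esub> \<longleftrightarrow> a \<otimes>\<^bsub>?S\<^esub> b = \<zero>\<^bsub>?S\<^esub>"
        by (rule Sigma_compatible_single[OF Sigma i ab])
      show "a \<otimes>\<^bsub>?S\<^esub> \<delta> i b = \<zero>\<^bsub>?S\<^esub>" if "a \<otimes>\<^bsub>?S\<^esub> b = \<zero>\<^bsub>?S\<^esub>"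
        using that by (rule Delta_compatible_single[OF Delta i ab])
    qed
    show "\<delta> i r \<in> nilpotents ?S" if "r \<in> nilpotents ?S" for r
      using that by (rule D.d_nilpotents)
  qed
  show "nilpotently_generated A (weak_annihilator A {f})"
  proof (rule P.weak_annihilator_nilpotently_generated[OF _ c _ f])
    show "nilpotents ?S = {c \<otimes>\<^bsub>A\<^esub> s | s. s \<in> R}" using N by simp
    show "c \<in> nilpotents A" using c nil_sub by blast
  qed
qed

end
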